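(* Let $\mathbb P_N$ be the probability distribution on $\mathfrak X^\theta_N$ described in the context. Let $\mathcal M\subset\mathbb C$ be open with $$\bigcup_{i=1}^k\Big([q^{1-a_i-N_{i-1}\theta},\,q^{-b_i-(N_i-1)\theta}]\cup[uq^{b_i+(N_i-1)\theta},\,uq^{a_i-1+N_{i-1}\theta}]\Big)\subset\mathcal M.$$ Suppose there exist two functions $\Phi^+(z),\Phi^-(z)$ analytic in $\mathcal M$ such that $$\frac{w(\sigma(z);N)}{w(\sigma(qz);N)}=\frac{(q^2z^2-uq^\theta)(z^2-u)\,\Phi^+(z)}{(q^\theta z^2-u)(q^2z^2-u)\,\Phi^-(z)}\quad\text{whenever }\sigma(z),\sigma(qz)\in\bigcup_{i=1}^k[\alpha_i,\beta_i^-],$$ where $\sigma(z)=z+uz^{-1}$. Also assume that for each $i\in\{1,\dots,k\}$ $$\Phi^+(q^{-b_i-(N_i-1)\theta})=\Phi^-(q^{-a_i-N_{i-1}\theta})=\Phi^+(uq^{a_i-1+N_{i-1}\theta})=\Phi^-(uq^{b_i-1+(N_i-1)\theta})=0.$$ Define $$\tilde R(z)=\Phi^-(z)\,\mathbb E_{\mathbb P_N}\left[\prod_{i=1}^N\frac{\sigma(q^\theta z)-\ell_i}{\sigma(z)-\ell_i}\right]+\Phi^+(z)\,\mathbb E_{\mathbb P_N}\left[\prod_{i=1}^N\frac{\sigma(q^{1-\theta}z)-\ell_i}{\sigma(qz)-\ell_i}\right].$$ Then $\tilde R(z)$ is analytic in $\mathcal M$. Moreover, if $\Phi^\pm(z)$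 are polynomials of degree at most $d$, then so is $\tilde R(z)$.
   Context: Let $q\in(0,1)$, $u\in[0,1)$, $\theta>0$, $M\in\mathbb Z_{\ge0}$, $N\in\mathbb N$ with $M\ge N-1$, $k\in\mathbb N$; integers $n_1,\dots,n_k$, $N_j=\sum_{i\le j}n_i$, $N_0=0$, $N_k=N$; integers $a_i,b_i$ with $0\le a_i\le b_i-1\le M-N+1$ and $b_i\le a_{i+1}$. The state space $\mathfrak X^\theta_N$ is the set of $(\ell_1,\dots,\ell_N)$ with $\ell_i=q^{-\lambda_i}+uq^{\lambda_i}$, $\lambda_i=x_i+(i-1)\theta$, $x_1\le\dots\le x_N$ integers, $a_j\le x_i\le b_j-1$ whenever $N_{j-1}+1\le i\le N_j$. Put $\alpha_i=q^{-a_i-N_{i-1}\theta}+uq^{a_i+N_{i-1}\theta}$ and $\beta_i^-=q^{-(b_i-1)-(N_i-1)\theta}+uq^{(b_i-1)+(N_i-1)\theta}$. The measure is $$\mathbb P_N(\ell)=\frac1{Z_N}\prod_{i<j}H(\ell_i,\ell_j)\prod_{i=1}^Nw(\ell_i;N),$$ $$H(\ell_i,\ell_j)=q^{-2\theta\lambda_j}\frac{\Gamma_q(\lambda_j-\lambda_i+1)\Gamma_q(\lambda_j-\lambda_i+\theta)}{\Gamma_q(\lambda_j-\lambda_i)\Gamma_q(\lambda_j-\lambda_i+1-\theta)}\cdot\frac{\Gamma_q(\lambda_j+\lambda_i+v+1)\Gamma_q(\lambda_j+\lambda_i+v+\theta)}{\Gamma_q(\lambda_j+\lambda_i+v)\Gamma_q(\lambda_j+\lambda_i+v+1-\theta)},$$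 where $q^v=u$ (for $u=0$ the last fraction is a constant and is dropped), $\Gamma_q(x)=(1-q)^{1-x}\frac{(q;q)_\infty}{(q^x;q)_\infty}$, $(a;q)_\infty=\prod_{j\ge0}(1-aq^j)$, $Z_N$ is the normalization, and $w(\cdot;N)$ is positive on $\bigcup_i[\alpha_i,\beta_i^-]$. "Analytic" and "polynomial" mean that $\tilde R$, a priori defined away from finitely many points, extends to such a function. *)

theory Defs
  imports "HOL-Analysis.Analysis" "HOL-Computational_Algebra.Polynomial"
begin

definition qpochhammer_inf :: "real \<Rightarrow> real \<Rightarrow> real" where
  "qpochhammer_inf a q = (\<Prod>j. 1 - a * q ^ j)"

definition q_Gamma :: "real \<Rightarrow> real \<Rightarrow> real" where
  "q_Gamma q x = (1 - q) powr (1 - x) * (qpochhammer_inf q q / qpochhammer_inf (q powr x) q)"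

definition psum :: "(nat \<Rightarrow> nat) \<Rightarrow> nat \<Rightarrow> nat" where
  "psum n j = (\<Sum>i=1..j. n i)"

definition quad_lattice :: "real \<Rightarrow> real \<Rightarrow> real \<Rightarrow> real" where
  "quad_lattice q u s = q powr (- s) + u * q powr s"

text \<open>For \<open>0 < q < 1\<close> and \<open>0 \<le> u < 1\<close> the map \<open>quad_lattice q u\<close> is strictly increasing on
  \<open>[0, \<infinity>)\<close>, and every exponent \<open>x\<^sub>i + (i - 1) \<theta>\<close> occurring in the state space is nonnegative; hence
  the exponent of a particle is recovered from its position by the following inverse.\<close>

definition lattice_exponent :: "real \<Rightarrow> real \<Rightarrow> real \<Rightarrow> real" where
  "lattice_exponent q u = inv_into {0..} (quad_lattice q u)"

definition alpha :: "real \<Rightarrow> real \<Rightarrow> real \<Rightarrow> (nat \<Rightarrow> nat) \<Rightarrow> (nat \<Rightarrow> int) \<Rightarrow> nat \<Rightarrow> real" where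
  "alpha q u \<theta> n a i = quad_lattice q u (real_of_int (a i) + real (psum n (i - 1)) * \<theta>)"

definition beta_minus :: "real \<Rightarrow> real \<Rightarrow> real \<Rightarrow> (nat \<Rightarrow> nat) \<Rightarrow> (nat \<Rightarrow> int) \<Rightarrow> nat \<Rightarrow> real" where
  "beta_minus q u \<theta> n b i =
     quad_lattice q u ((real_of_int (b i) - 1) + (real (psum n i) - 1) * \<theta>)"

definition bands ::
  "real \<Rightarrow> real \<Rightarrow> real \<Rightarrow> nat \<Rightarrow> (nat \<Rightarrow> nat) \<Rightarrow> (nat \<Rightarrow> int) \<Rightarrow> (nat \<Rightarrow> int) \<Rightarrow> real set" where
  "bands q u \<theta> k n a b = (\<Union>i\<in>{1..k}. {alpha q u \<theta> n a i .. beta_minus q u \<theta> n b i})"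

text \<open>An \<open>N\<close>-tuple is a function on \<open>{1..N}\<close> (extensional, so that distinct functions in the state
  space are distinct tuples).\<close>

definition state_space ::
  "real \<Rightarrow> real \<Rightarrow> real \<Rightarrow> nat \<Rightarrow> nat \<Rightarrow> (nat \<Rightarrow> nat) \<Rightarrow> (nat \<Rightarrow> int) \<Rightarrow> (nat \<Rightarrow> int) \<Rightarrow> (nat \<Rightarrow> real) set"
  where
  "state_space q u \<theta> N k n a b =
     {restrict (\<lambda>i. quad_lattice q u (real_of_int (x i) + (real i - 1) * \<theta>)) {1..N} | x :: nat \<Rightarrow> int.
        mono_on {1..N} x \<and>
        (\<forall>j\<in>{1..k}. \<forall>i\<in>{psum n (j - 1) + 1..psum n j}. a j \<le> x i \<and> x i \<le> b j - 1)}"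

definition Gamma_quotient :: "real \<Rightarrow> real \<Rightarrow> real \<Rightarrow> real" where
  "Gamma_quotient q \<theta> x =
     (q_Gamma q (x + 1) * q_Gamma q (x + \<theta>)) / (q_Gamma q x * q_Gamma q (x + 1 - \<theta>))"

text \<open>Here \<open>v = log q u\<close>, i.e. \<open>q powr v = u\<close>, when \<open>u > 0\<close>.\<close>

definition interaction :: "real \<Rightarrow> real \<Rightarrow> real \<Rightarrow> real \<Rightarrow> real \<Rightarrow> real" where
  "interaction q u \<theta> l m =
     (let s = lattice_exponent q u l; t = lattice_exponent q u m in
        q powr (- 2 * \<theta> * t) * Gamma_quotient q \<theta> (t - s) *
        (if u = 0 then 1 else Gamma_quotient q \<theta> (t + s + log q u)))"

definition weight :: "real \<Rightarrow> real \<Rightarrow> real \<Rightarrow> nat \<Rightarrow> (real \<Rightarrow> real) \<Rightarrow> (nat \<Rightarrow> real) \<Rightarrow> real" where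
  "weight q u \<theta> N w l =
     (\<Prod>j\<in>{1..N}. \<Prod>i\<in>{1..<j}. interaction q u \<theta> (l i) (l j)) * (\<Prod>i\<in>{1..N}. w (l i))"

definition log_gas ::
  "real \<Rightarrow> real \<Rightarrow> real \<Rightarrow> nat \<Rightarrow> nat \<Rightarrow> (nat \<Rightarrow> nat) \<Rightarrow> (nat \<Rightarrow> int) \<Rightarrow> (nat \<Rightarrow> int) \<Rightarrow>
   (real \<Rightarrow> real) \<Rightarrow> (nat \<Rightarrow> real) measure" where
  "log_gas q u \<theta> N k n a b w =
     (let X = state_space q u \<theta> N k n a b; Z = (\<Sum>l\<in>X. weight q u \<theta> N w l)
      in point_measure X (\<lambda>l. ennreal (weight q u \<theta> N w l / Z)))"

definition sigma :: "real \<Rightarrow> complex \<Rightarrow> complex" where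
  "sigma u z = z + of_real u / z"

definition R_tilde ::
  "real \<Rightarrow> real \<Rightarrow> real \<Rightarrow> nat \<Rightarrow> (nat \<Rightarrow> real) measure \<Rightarrow> (complex \<Rightarrow> complex) \<Rightarrow>
   (complex \<Rightarrow> complex) \<Rightarrow> complex \<Rightarrow> complex" where
  "R_tilde q u \<theta> N P \<Phi>p \<Phi>m z =
     \<Phi>m z * (\<integral>l. (\<Prod>i=1..N. (sigma u (of_real (q powr \<theta>) * z) - of_real (l i)) /
                            (sigma u z - of_real (l i))) \<partial>P) +
     \<Phi>p z * (\<integral>l. (\<Prod>i=1..N. (sigma u (of_real (q powr (1 - \<theta>)) * z) - of_real (l i)) /
                            (sigma u (of_real q * z) - of_real (l i))) \<partial>P)"

text \<open>The finitely many points at which the formula for \<open>R_tilde\<close> divides by zero. (For \<open>u = 0\<close>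
  one has \<open>\<sigma>(z) = z\<close>, also in the formal definition, so the origin is then not exceptional.)\<close>

definition exceptional_points ::
  "real \<Rightarrow> real \<Rightarrow> nat \<Rightarrow> (nat \<Rightarrow> real) set \<Rightarrow> complex set" where
  "exceptional_points q u N X =
     {z. (z = 0 \<and> u \<noteq> 0) \<or>
         (\<exists>l\<in>X. \<exists>i\<in>{1..N}. sigma u z = of_real (l i) \<or> sigma u (of_real q * z) = of_real (l i))}"

text \<open>The identity
  \<open>w(\<sigma>(z)) / w(\<sigma>(qz)) = (q\<^sup>2z\<^sup>2 - uq\<^sup>\<theta>)(z\<^sup>2 - u)\<Phi>\<^sup>+(z) / ((q\<^sup>\<theta>z\<^sup>2 - u)(q\<^sup>2z\<^sup>2 - u)\<Phi>\<^sup>-(z))\<close>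
  is written with denominators cleared, because the right-hand side may have removable
  singularities: for \<open>\<theta> = 1\<close> the factor \<open>qz\<^sup>2 - u\<close> cancels, but at \<open>qz\<^sup>2 = u\<close>, which is an admissible
  point if \<open>u \<ge> q\<close> and \<open>a\<^sub>1 = 0\<close>, totalized division would turn the quotient into \<open>0\<close>.
  Since \<open>w > 0\<close> on the bands, wherever the denominator is nonzero this is the identity of quotients.\<close>

definition weight_ratio_condition ::
  "real \<Rightarrow> real \<Rightarrow> real \<Rightarrow> real set \<Rightarrow> (real \<Rightarrow> real) \<Rightarrow> complex set \<Rightarrow> (complex \<Rightarrow> complex) \<Rightarrow>
   (complex \<Rightarrow> complex) \<Rightarrow> bool" where
  "weight_ratio_condition q u \<theta> B w U \<Phi>p \<Phi>m \<longleftrightarrow>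
     (\<forall>z\<in>U. \<forall>x\<in>B. \<forall>y\<in>B. sigma u z = of_real x \<and> sigma u (of_real q * z) = of_real y \<longrightarrow>
        of_real (w x) *
          ((of_real (q powr \<theta>) * z\<^sup>2 - of_real u) * (of_real (q\<^sup>2) * z\<^sup>2 - of_real u) * \<Phi>m z) =
        of_real (w y) *
          ((of_real (q\<^sup>2) * z\<^sup>2 - of_real (u * q powr \<theta>)) * (z\<^sup>2 - of_real u) * \<Phi>p z))"

end

theory Submission
  imports Defs "HOL-Complex_Analysis.Complex_Analysis"
begin

text \<open>All singularities of \<open>R_tilde\<close> away from the origin are simple poles, and the residues cancel in
  pairs. If \<open>z = q powr (- s)\<close>, the first expectation has a pole coming from a configuration with a
  particle of exponent \<open>s\<close>, and the second one from the configuration in which that particle is moved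
  to exponent \<open>s - 1\<close>; for \<open>z = u * q powr (s - 1)\<close> the two roles are exchanged. The functional equation
  of \<open>q_Gamma\<close> and the weight ratio condition make the two residues opposite. A particle that cannot
  be moved either is blocked by its neighbour, and then the residue contains a vanishing factor, or
  sits at the end of its band, where \<open>\<Phi>\<^sup>+\<close> or \<open>\<Phi>\<^sup>-\<close> vanishes. In the polynomial case the resulting
  entire function grows at most like \<open>z ^ d\<close>, so Liouville's theorem applies.\<close>

section \<open>Shift relations for the interaction\<close>

text \<open>The rational factor in the weight ratio condition is what the moving particle itself
  contributes to the two residues: a difference of sigma values divided by the derivative of the
  singular denominator. The other N - 1 particles enter through lattice differences, which factor
  into a term in t - s and a term in t + s; these two terms absorb the two Gamma quotients
  separately. Since a move keeps all labels, the cancellation holds for each label i on its own,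
  after summation over configurations. The delicate points are at the margins. A move from s to s -
  1 needs 1 \<le> s, because exponents must stay where the lattice map is inverted. A particle at a
  pole with exponent below 1 may have no partner configuration, and then its residue term has to
  vanish by itself. Simplicity of the poles rests on distinct positions within a configuration and
  on u < 1, which keeps the poles off the critical points of sigma. At the origin both expectations
  have finite limits.\<close>

lemma convergent_prod_qpochhammer:
  fixes a q :: real
  assumes "0 < q" "q < 1" "0 < a" "a < 1"
  shows "convergent_prod (\<lambda>j. 1 - a * q ^ j)"
proof -
  have "a * q ^ j < 1" for j
    using assms mult_less_le_imp_less[of a 1 "q ^ j" 1] by (simp add: power_le_one)
  then have "- (a * q ^ j) \<noteq> - 1" for j
    by (metis less_irrefl neg_equal_iff_equal)
  moreover have "summable (\<lambda>j. \<bar>- (a * q ^ j)\<bar>)"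
    using assms by (simp add: abs_mult summable_mult summable_geometric)
  ultimately have "convergent_prod (\<lambda>j. 1 + - (a * q ^ j))"
    by (intro summable_imp_convergent_prod_real) auto
  then show ?thesis by simp
qed

lemma qpochhammer_inf_pos:
  assumes "0 < q" "q < 1" "0 < a" "a < 1"
  shows "0 < qpochhammer_inf a q"
  unfolding qpochhammer_inf_def
proof (rule less_0_prodinf[OF convergent_prod_qpochhammer[OF assms]])
  show "0 < 1 - a * q ^ j" for j
    using assms mult_less_le_imp_less[of a 1 "q ^ j" 1] by (simp add: power_le_one)
qed

lemma qpochhammer_inf_rec:
  assumes "0 < q" "q < 1" "0 < a" "a < 1"
  shows "qpochhammer_inf a q = (1 - a) * qpochhammer_inf (a * q) q"
proof -
  have "qpochhammer_inf a q = (\<Prod>j. 1 - a * q ^ Suc j) * (1 - a * q ^ 0)"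
    unfolding qpochhammer_inf_def
    using prodinf_split_head[OF convergent_prod_qpochhammer[OF assms]] assms by simp
  then show ?thesis by (simp add: qpochhammer_inf_def mult_ac)
qed

lemma powr_less_1:
  fixes q x :: real
  assumes "0 < q" "q < 1" "0 < x"
  shows "q powr x < 1"
  using powr_less_mono'[of q 0 x] assms by simp

lemma q_Gamma_pos:
  assumes "0 < q" "q < 1" "0 < x"
  shows "0 < q_Gamma q x"
proof -
  have "0 < qpochhammer_inf q q" "0 < qpochhammer_inf (q powr x) q"
    using assms powr_less_1[OF assms] by (auto intro!: qpochhammer_inf_pos)
  then show ?thesis using assms by (simp add: q_Gamma_def)
qed

text \<open>The classical functional equation of the q-Gamma function: the infinite product loses
  its first factor and the exponent of 1 - q drops by one.\<close>

lemma q_Gamma_plus_1: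
  assumes "0 < q" "q < 1" "0 < x"
  shows "q_Gamma q (x + 1) = (1 - q powr x) / (1 - q) * q_Gamma q x"
proof -
  have a: "0 < q powr x" "q powr x < 1" using assms powr_less_1[OF assms] by auto
  have "qpochhammer_inf (q powr x) q = (1 - q powr x) * qpochhammer_inf (q powr (x + 1)) q"
    using qpochhammer_inf_rec[OF assms(1,2) a] assms by (simp add: powr_add)
  moreover have "(1 - q) powr (1 - x) = (1 - q) powr (1 - (x + 1)) * (1 - q)"
    using assms powr_add[of "1 - q" "- x" 1] by simp
  ultimately show ?thesis
    using a assms qpochhammer_inf_pos[OF assms(1,2) a]
    unfolding q_Gamma_def by (simp add: divide_simps)
qed

lemma Gamma_quotient_pos:
  assumes "0 < q" "q < 1" "0 < \<theta>" "0 < x" "0 < x + 1 - \<theta>"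
  shows "0 < Gamma_quotient q \<theta> x"
  unfolding Gamma_quotient_def using assms by (simp add: q_Gamma_pos)

text \<open>The shift produces two factors 1 / (1 - q) above and two below, which cancel, leaving
  one factor 1 - q powr _ for each of the four arguments. The lower bound on x + 1 - \<theta> keeps
  every argument of \<open>q_Gamma\<close> positive.\<close>

lemma Gamma_quotient_plus_1:
  assumes "0 < q" "q < 1" "0 < \<theta>" "0 < x" "0 < x + 1 - \<theta>"
  shows "Gamma_quotient q \<theta> (x + 1) =
    Gamma_quotient q \<theta> x *
      ((1 - q powr (x + 1)) * (1 - q powr (x + \<theta>)) / ((1 - q powr x) * (1 - q powr (x + 1 - \<theta>))))"
proof -
  have shift: "q_Gamma q ((x + 1) + 1) = (1 - q powr (x + 1)) / (1 - q) * q_Gamma q (x + 1)"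
       "q_Gamma q ((x + \<theta>) + 1) = (1 - q powr (x + \<theta>)) / (1 - q) * q_Gamma q (x + \<theta>)"
       "q_Gamma q (x + 1) = (1 - q powr x) / (1 - q) * q_Gamma q x"
       "q_Gamma q ((x + 1 - \<theta>) + 1) = (1 - q powr (x + 1 - \<theta>)) / (1 - q) * q_Gamma q (x + 1 - \<theta>)"
    by (rule q_Gamma_plus_1; use assms in simp)+
  have arg: "x + 1 + \<theta> = x + \<theta> + 1" "x + 1 + 1 - \<theta> = x + 1 - \<theta> + 1" by auto
  have nz: "q_Gamma q x > 0" "q_Gamma q (x + 1 - \<theta>) > 0" "1 - q > 0"
    "1 - q powr x > 0" "1 - q powr (x + 1 - \<theta>) > 0"
    using assms q_Gamma_pos powr_less_1[of q x] powr_less_1[of q "x + 1 - \<theta>"] by auto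
  \<comment> \<open>Over free variables this is plain cancellation. The value
    \<open>q_Gamma q (x + 1)\<close> appears as c0 / r * g0 because \<open>shift\<close> rewrites it
    on both sides.\<close>
  have *: "(c1 / r * (c0 / r * g0)) * (ct / r * gt) / ((c0 / r * g0) * (cm / r * gm))
     = (c0 / r * g0) * gt / (g0 * gm) * (c1 * ct / (c0 * cm))"
    if "g0 > 0" "gm > 0" "r > 0" "c0 > 0" "cm > 0" for g0 gm gt r c0 c1 ct cm :: real
    using that by (simp add: divide_simps)
  show ?thesis
    unfolding Gamma_quotient_def arg shift by (rule *) (use nz in auto)
qed

text \<open>\<open>u = q powr v\<close> enters only through \<open>log q u\<close>, which is junk at \<open>u = 0\<close>; the shift relation below
  holds uniformly because every factor \<open>1 - u * q powr _\<close> is then \<open>1\<close>.\<close>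

definition sum_Gamma_quotient :: "real \<Rightarrow> real \<Rightarrow> real \<Rightarrow> real \<Rightarrow> real" where
  "sum_Gamma_quotient q u \<theta> y = (if u = 0 then 1 else Gamma_quotient q \<theta> (y + log q u))"

text \<open>Strict positivity of v = log q u is the reason why weak inequalities on y and y + 1 -
  \<theta> suffice in the two lemmas below.\<close>

lemma log_base_less_1_pos:
  fixes q u :: real
  assumes "0 < q" "q < 1" "0 < u" "u < 1"
  shows "0 < log q u"
  using assms by (simp add: log_def divide_neg_neg)

lemma sum_Gamma_quotient_pos:
  assumes "0 < q" "q < 1" "0 \<le> u" "u < 1" "0 < \<theta>" "0 \<le> y" "0 \<le> y + 1 - \<theta>"
  shows "0 < sum_Gamma_quotient q u \<theta> y"
  unfolding sum_Gamma_quotient_def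
  using assms log_base_less_1_pos[of q u] by (auto intro!: Gamma_quotient_pos)

lemma sum_Gamma_quotient_plus_1:
  assumes "0 < q" "q < 1" "0 \<le> u" "u < 1" "0 < \<theta>" "0 \<le> y" "0 \<le> y + 1 - \<theta>"
  shows "sum_Gamma_quotient q u \<theta> (y + 1) =
    sum_Gamma_quotient q u \<theta> y * ((1 - u * q powr (y + 1)) * (1 - u * q powr (y + \<theta>)) /
       ((1 - u * q powr y) * (1 - u * q powr (y + 1 - \<theta>))))"
proof (cases "u = 0")
  case True
  then show ?thesis by (simp add: sum_Gamma_quotient_def)
next
  case False
  let ?v = "log q u"
  have v: "0 < ?v" "q powr ?v = u" using False assms log_base_less_1_pos[of q u] by auto
  have "q powr (z + ?v) = u * q powr z" for z
    using v by (simp add: powr_add)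
  from this[of "y + 1"] this[of "y + \<theta>"] this[of y] this[of "y + 1 - \<theta>"]
  show ?thesis
    using Gamma_quotient_plus_1[of q \<theta> "y + ?v"] v False assms
    by (simp add: sum_Gamma_quotient_def algebra_simps)
qed

text \<open>From the factorisation (q^(-s) - q^(-t)) (1 - u q^(s+t)). It separates the dependence on
  t - s from that on s + t, matching the two Gamma quotients of the interaction.\<close>

lemma quad_lattice_diff:
  assumes "0 < q"
  shows "quad_lattice q u s - quad_lattice q u t =
    q powr (- t) * (q powr (t - s) - 1) * (1 - u * q powr (s + t))"
  using assms
  by (simp add: quad_lattice_def powr_add powr_diff powr_minus field_simps)

lemma u_powr_less_1:
  fixes q u x :: real
  assumes "0 < q" "q < 1" "0 \<le> u" "u < 1" "0 \<le> x"
  shows "u * q powr x < 1"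
proof -
  have "q powr x \<le> 1" using assms powr_mono'[of 0 x q] by simp
  then have "u * q powr x \<le> u * 1" using assms by (intro mult_left_mono) auto
  with assms show ?thesis by simp
qed

lemma quad_lattice_strict_mono:
  assumes "0 < q" "q < 1" "0 \<le> u" "u < 1" "0 \<le> s" "s < t"
  shows "quad_lattice q u s < quad_lattice q u t"
proof -
  have "0 < q powr (- s) * (1 - q powr (t - s)) * (1 - u * q powr (t + s))"
    using powr_less_1[of q "t - s"] u_powr_less_1[of q u "t + s"] assms by simp
  moreover have "quad_lattice q u t - quad_lattice q u s
     = q powr (- s) * (q powr (s - t) - 1) * (1 - u * q powr (t + s))"
    using quad_lattice_diff assms by blast
  moreover have "q powr (s - t) - 1 > 0"
    using powr_less_mono'[of q "s - t" 0] assms by simp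
  ultimately show ?thesis
    using u_powr_less_1[of q u "t + s"] assms
    by (smt (verit) mult_pos_pos powr_gt_zero)
qed

lemma inj_on_quad_lattice:
  assumes "0 < q" "q < 1" "0 \<le> u" "u < 1"
  shows "inj_on (quad_lattice q u) {0..}"
  by (intro linorder_inj_onI') (use quad_lattice_strict_mono[OF assms] in \<open>force\<close>)

lemma lattice_exponent_quad_lattice:
  assumes "0 < q" "q < 1" "0 \<le> u" "u < 1" "0 \<le> s"
  shows "lattice_exponent q u (quad_lattice q u s) = s"
  unfolding lattice_exponent_def
  by (rule inv_into_f_f[OF inj_on_quad_lattice]) (use assms in auto)

section \<open>The pair interaction on lattice points\<close>

lemma interaction_quad_lattice:
  assumes "0 < q" "q < 1" "0 \<le> u" "u < 1" "0 \<le> s" "0 \<le> t"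
  shows "interaction q u \<theta> (quad_lattice q u s) (quad_lattice q u t) =
    q powr (- 2 * \<theta> * t) * Gamma_quotient q \<theta> (t - s) * sum_Gamma_quotient q u \<theta> (t + s)"
  using assms by (simp add: interaction_def lattice_exponent_quad_lattice sum_Gamma_quotient_def)

lemma interaction_pos:
  assumes "0 < q" "q < 1" "0 \<le> u" "u < 1" "0 < \<theta>" "0 \<le> s" "\<theta> \<le> t - s"
  shows "0 < interaction q u \<theta> (quad_lattice q u s) (quad_lattice q u t)"
  using assms by (simp add: interaction_quad_lattice Gamma_quotient_pos sum_Gamma_quotient_pos)

text \<open>Moving the left particle from s to s - 1 widens the gap t - s and lowers the sum s + t,
  each by one, while the power of q depends on t alone. The factors gained from the two Gamma
  quotients match the four lattice differences. The exponents s - \<theta> and s - 1 + \<theta>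
  belong to the values of sigma at q^\<theta> z and q^(1-\<theta>) z for z = q^(-s).\<close>

lemma interaction_shift_left:
  assumes "0 < q" "q < 1" "0 \<le> u" "u < 1" "0 < \<theta>" "1 \<le> s" "\<theta> \<le> t - s"
  defines "L \<equiv> quad_lattice q u"
  shows "interaction q u \<theta> (L s) (L t) * ((L (s - \<theta>) - L t) / (L s - L t)) =
    interaction q u \<theta> (L (s - 1)) (L t) * ((L (s - 1 + \<theta>) - L t) / (L (s - 1) - L t))"
proof -
  \<comment> \<open>The gap before the move and the sum after it, so that both shift relations are
    applied upwards.\<close>
  define x y where "x = t - s" and "y = s + t - 1"
  define g e where "g = Gamma_quotient q \<theta> x" and "e = sum_Gamma_quotient q u \<theta> y"
  have G: "Gamma_quotient q \<theta> (x + 1) = g *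
      ((1 - q powr (x + 1)) * (1 - q powr (x + \<theta>)) / ((1 - q powr x) * (1 - q powr (x + 1 - \<theta>))))"
    unfolding g_def by (rule Gamma_quotient_plus_1) (use assms x_def in auto)
  have E: "sum_Gamma_quotient q u \<theta> (y + 1) = e *
     ((1 - u * q powr (y + 1)) * (1 - u * q powr (y + \<theta>)) /
       ((1 - u * q powr y) * (1 - u * q powr (y + 1 - \<theta>))))"
    unfolding e_def by (rule sum_Gamma_quotient_plus_1) (use assms y_def in auto)
  have I: "interaction q u \<theta> (L s) (L t) =
             q powr (- 2 * \<theta> * t) * g * sum_Gamma_quotient q u \<theta> (y + 1)"
          "interaction q u \<theta> (L (s - 1)) (L t) =
             q powr (- 2 * \<theta> * t) * Gamma_quotient q \<theta> (x + 1) * e"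
    using assms interaction_quad_lattice[of q u s t \<theta>] interaction_quad_lattice[of q u "s - 1" t \<theta>]
    unfolding g_def e_def x_def y_def by (auto simp: algebra_simps)
  have D: "L s - L t = q powr (- t) * (q powr x - 1) * (1 - u * q powr (y + 1))"
    "L (s - \<theta>) - L t = q powr (- t) * (q powr (x + \<theta>) - 1) * (1 - u * q powr (y + 1 - \<theta>))"
    "L (s - 1) - L t = q powr (- t) * (q powr (x + 1) - 1) * (1 - u * q powr y)"
    "L (s - 1 + \<theta>) - L t = q powr (- t) * (q powr (x + 1 - \<theta>) - 1) * (1 - u * q powr (y + \<theta>))"
    unfolding L_def x_def y_def using assms by (simp_all add: quad_lattice_diff algebra_simps)
  have nz: "1 - q powr x > 0" "1 - q powr (x + 1) > 0" "1 - q powr (x + 1 - \<theta>) > 0"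
    "1 - u * q powr y > 0" "1 - u * q powr (y + 1) > 0" "1 - u * q powr (y + 1 - \<theta>) > 0"
    using assms by (auto intro!: powr_less_1 u_powr_less_1 simp: x_def y_def)
  have *: "k * g * (e * (b1 * bt / (b0 * b1t))) * ((p * (ath - 1) * b1t) / (p * (a0 - 1) * b1))
     = k * (g * ((1 - a1) * (1 - ath) / ((1 - a0) * (1 - a1t)))) * e
         * ((p * (a1t - 1) * bt) / (p * (a1 - 1) * b0))"
    if "p \<noteq> 0" "1 - a0 > 0" "1 - a1 > 0" "1 - a1t > 0" "b0 > 0" "b1 > 0" "b1t > 0"
    for k p a0 a1 ath a1t b0 b1 bt b1t :: real
  proof -
    have "(p * (ath - 1) * b1t) / (p * (a0 - 1) * b1) = (1 - ath) * b1t / ((1 - a0) * b1)"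
      "(p * (a1t - 1) * bt) / (p * (a1 - 1) * b0) = (1 - a1t) * bt / ((1 - a1) * b0)"
      using that by (simp_all add: divide_simps) (auto simp: algebra_simps)
    then show ?thesis using that by (simp add: mult_ac)
  qed
  show ?thesis
    unfolding I D E G by (rule *) (use nz assms(1) in auto)
qed

text \<open>Here the right particle moves, so gap and sum both drop by one and the power of q
  changes too. Its gain q^(2\<theta>) is compensated by the powers q^\<theta> and q^(-\<theta>) in
  the shifted lattice differences. The bound on s - 1 - t is the gap that must remain after the
  move.\<close>

lemma interaction_shift_right:
  assumes "0 < q" "q < 1" "0 \<le> u" "u < 1" "0 < \<theta>" "0 \<le> t" "\<theta> \<le> s - 1 - t"
  defines "L \<equiv> quad_lattice q u"
  shows "interaction q u \<theta> (L t) (L s) * ((L (s - \<theta>) - L t) / (L s - L t)) =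
    interaction q u \<theta> (L t) (L (s - 1)) * ((L (s - 1 + \<theta>) - L t) / (L (s - 1) - L t))"
proof -
  define x y where "x = s - 1 - t" and "y = s + t - 1"
  define g e where "g = Gamma_quotient q \<theta> x" and "e = sum_Gamma_quotient q u \<theta> y"
  have G: "Gamma_quotient q \<theta> (x + 1) = g *
      ((1 - q powr (x + 1)) * (1 - q powr (x + \<theta>)) / ((1 - q powr x) * (1 - q powr (x + 1 - \<theta>))))"
    unfolding g_def by (rule Gamma_quotient_plus_1) (use assms x_def in auto)
  have E: "sum_Gamma_quotient q u \<theta> (y + 1) = e *
     ((1 - u * q powr (y + 1)) * (1 - u * q powr (y + \<theta>)) /
       ((1 - u * q powr y) * (1 - u * q powr (y + 1 - \<theta>))))"
    unfolding e_def by (rule sum_Gamma_quotient_plus_1) (use assms y_def in auto)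
  define k where "k = q powr (- 2 * \<theta> * s)"
  define h where "h = q powr \<theta>"
  have k: "q powr (- 2 * \<theta> * (s - 1)) = k * (h * h)"
    unfolding k_def h_def by (simp add: powr_add[symmetric] algebra_simps)
  have I: "interaction q u \<theta> (L t) (L s) =
             k * Gamma_quotient q \<theta> (x + 1) * sum_Gamma_quotient q u \<theta> (y + 1)"
    using assms interaction_quad_lattice[of q u t s \<theta>]
    unfolding k_def x_def y_def by (simp add: add.commute)
  have I': "interaction q u \<theta> (L t) (L (s - 1)) = k * (h * h) * g * e"
    using assms interaction_quad_lattice[of q u t "s - 1" \<theta>]
    unfolding k g_def e_def x_def y_def by (simp add: algebra_simps)
  \<comment> \<open>The power of the moving exponent is pulled out; the remaining brackets are then
    those occurring in \<open>G\<close> and \<open>E\<close>.\<close>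
  have swap: "L s' - L t = q powr (- s') * (1 - q powr (s' - t)) * (1 - u * q powr (t + s'))" for s'
    using quad_lattice_diff[of q u t s'] assms(1) unfolding L_def by (simp add: algebra_simps)
  define r where "r = q powr (- s)"
  have r: "q powr (- (s - \<theta>)) = r * h" "q powr (- (s - 1)) = r * q" "q powr (- (s - 1 + \<theta>)) = r * q / h"
    unfolding r_def h_def using assms(1)
    by (simp_all add: powr_add[symmetric] powr_diff algebra_simps)
       (simp_all add: powr_add powr_diff powr_minus field_simps)
  have D: "L s - L t = r * (1 - q powr (x + 1)) * (1 - u * q powr (y + 1))"
    "L (s - \<theta>) - L t = r * h * (1 - q powr (x + 1 - \<theta>)) * (1 - u * q powr (y + 1 - \<theta>))"
    "L (s - 1) - L t = r * q * (1 - q powr x) * (1 - u * q powr y)"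
    "L (s - 1 + \<theta>) - L t = r * q / h * (1 - q powr (x + \<theta>)) * (1 - u * q powr (y + \<theta>))"
    unfolding swap r x_def y_def r_def[symmetric] by (simp_all add: algebra_simps)
  have nz: "1 - q powr x > 0" "1 - q powr (x + 1) > 0" "1 - q powr (x + 1 - \<theta>) > 0"
    "1 - u * q powr y > 0" "1 - u * q powr (y + 1) > 0" "1 - u * q powr (y + 1 - \<theta>) > 0"
    using assms by (auto intro!: powr_less_1 u_powr_less_1 simp: x_def y_def)
  have *: "k * (g * (a1 * ath / (a0 * a1t))) * (e * (b1 * bt / (b0 * b1t)))
            * ((r * h * a1t * b1t) / (r * a1 * b1))
     = k * (h * h) * g * e * ((r * q / h * ath * bt) / (r * q * a0 * b0))"
    if "r > 0" "h > 0" "q > 0" "a0 > 0" "a1 > 0" "a1t > 0" "b0 > 0" "b1 > 0" "b1t > 0"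
    for a0 a1 ath a1t b0 b1 bt b1t :: real
    using that by (simp add: divide_simps)
  show ?thesis
    unfolding I I' D E G by (rule *) (use nz assms(1) r_def h_def in auto)
qed

section \<open>Configurations and single-particle moves\<close>

lemma psum_mono: "i \<le> j \<Longrightarrow> psum n i \<le> psum n j"
  unfolding psum_def by (intro sum_mono2) auto

lemma psum_cover:
  assumes "i \<in> {1..psum n k}"
  obtains j where "j \<in> {1..k}" "i \<in> {psum n (j - 1) + 1..psum n j}"
proof -
  define j where "j = (LEAST j. i \<le> psum n j)"
  have j: "i \<le> psum n j" unfolding j_def by (rule LeastI[of _ k]) (use assms in auto)
  have "j \<le> k" unfolding j_def by (rule Least_le) (use assms in auto)
  moreover have "j \<noteq> 0" using j assms by (auto simp: psum_def intro!: Nat.gr0I)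
  moreover have "\<not> i \<le> psum n (j - 1)"
    using not_less_Least[of "j - 1" "\<lambda>j. i \<le> psum n j"] \<open>j \<noteq> 0\<close> unfolding j_def[symmetric] by auto
  ultimately show thesis using that[of j] j by auto
qed

text \<open>Isolates the pairs containing label i, the only ones affected when particle i moves. The
  conditional keeps the smaller label as first argument, since the interaction is not
  symmetric.\<close>

lemma prod_pairs_split:
  fixes f :: "nat \<Rightarrow> nat \<Rightarrow> 'a::comm_monoid_mult"
  assumes "i \<in> {1..N}"
  shows "(\<Prod>j\<in>{1..N}. \<Prod>p\<in>{1..<j}. f p j) =
    (\<Prod>j\<in>{1..N}-{i}. \<Prod>p\<in>{1..<j}-{i}. f p j) * (\<Prod>j\<in>{1..N}-{i}. if j < i then f j i else f i j)"
proof -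
  have "(\<Prod>j\<in>{1..N}. \<Prod>p\<in>{1..<j}. f p j)
      = (\<Prod>p\<in>{1..<i}. f p i) * (\<Prod>j\<in>{1..N}-{i}. \<Prod>p\<in>{1..<j}. f p j)"
    using assms by (subst prod.remove[of _ i]) auto
  also have "(\<Prod>j\<in>{1..N}-{i}. \<Prod>p\<in>{1..<j}. f p j)
      = (\<Prod>j\<in>{1..N}-{i}. (\<Prod>p\<in>{1..<j}-{i}. f p j) * (if i < j then f i j else 1))"
  proof (intro prod.cong refl)
    fix j assume "j \<in> {1..N}-{i}"
    show "(\<Prod>p\<in>{1..<j}. f p j) = (\<Prod>p\<in>{1..<j}-{i}. f p j) * (if i < j then f i j else 1)"
    proof (cases "i < j")
      case True
      then show ?thesis using assms by (subst prod.remove[of _ i]) (auto simp: mult.commute)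
    qed auto
  qed
  also have "\<dots> = (\<Prod>j\<in>{1..N}-{i}. \<Prod>p\<in>{1..<j}-{i}. f p j)
      * (\<Prod>j\<in>{1..N}-{i}. if i < j then f i j else 1)"
    by (rule prod.distrib)
  also have "(\<Prod>p\<in>{1..<i}. f p i) = (\<Prod>j\<in>{1..N}-{i}. if j < i then f j i else 1)"
    using assms by (intro prod.mono_neutral_cong_left) auto
  finally have "(\<Prod>j\<in>{1..N}. \<Prod>p\<in>{1..<j}. f p j) = (\<Prod>j\<in>{1..N}-{i}. \<Prod>p\<in>{1..<j}-{i}. f p j)
      * ((\<Prod>j\<in>{1..N}-{i}. if j < i then f j i else 1)
       * (\<Prod>j\<in>{1..N}-{i}. if i < j then f i j else 1))"
    by (simp add: mult_ac)
  also have "(\<Prod>j\<in>{1..N}-{i}. if j < i then f j i else 1)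
       * (\<Prod>j\<in>{1..N}-{i}. if i < j then f i j else 1)
      = (\<Prod>j\<in>{1..N}-{i}. if j < i then f j i else f i j)"
    unfolding prod.distrib[symmetric] by (intro prod.cong) auto
  finally show ?thesis .
qed

section \<open>The ensemble in integer coordinates\<close>

locale quadratic_ensemble =
  fixes q u \<theta> :: real and N k :: nat and n :: "nat \<Rightarrow> nat" and a b :: "nat \<Rightarrow> int"
    and w :: "real \<Rightarrow> real"
  assumes q: "0 < q" "q < 1" and u: "0 \<le> u" "u < 1" and \<theta>: "0 < \<theta>"
    and psum_k: "psum n k = N"
    and a_nonneg: "\<And>i. i \<in> {1..k} \<Longrightarrow> 0 \<le> a i"
    and w_pos: "\<And>x. x \<in> bands q u \<theta> k n a b \<Longrightarrow> 0 < w x"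
begin

abbreviation "L \<equiv> quad_lattice q u"
abbreviation "X \<equiv> state_space q u \<theta> N k n a b"
abbreviation "block j \<equiv> {psum n (j - 1) + 1..psum n j}"

definition exponent :: "(nat \<Rightarrow> int) \<Rightarrow> nat \<Rightarrow> real" where
  "exponent x i = real_of_int (x i) + (real i - 1) * \<theta>"

definition config :: "(nat \<Rightarrow> int) \<Rightarrow> nat \<Rightarrow> real" where
  "config x = restrict (\<lambda>i. L (exponent x i)) {1..N}"

definition admissible :: "(nat \<Rightarrow> int) \<Rightarrow> bool" where
  "admissible x \<longleftrightarrow> mono_on {1..N} x \<and>
     (\<forall>j\<in>{1..k}. \<forall>i\<in>block j. a j \<le> x i \<and> x i \<le> b j - 1)"

lemma state_space_eq: "X = config ` {x. admissible x}"
  unfolding state_space_def config_def admissible_def exponent_def by auto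

lemmas L_strict_mono = quad_lattice_strict_mono[OF q u]

lemma L_mono: "0 \<le> s \<Longrightarrow> s \<le> t \<Longrightarrow> L s \<le> L t"
  using L_strict_mono[of s t] by (cases "s = t") auto

lemma L_eq_iff: "0 \<le> s \<Longrightarrow> 0 \<le> t \<Longrightarrow> L s = L t \<longleftrightarrow> s = t"
  using inj_on_quad_lattice[OF q u] by (auto simp: inj_on_def)

lemma block_cover:
  assumes "i \<in> {1..N}"
  obtains j where "j \<in> {1..k}" "i \<in> block j"
  using assms psum_cover psum_k by blast

lemma block_subset: "j \<in> {1..k} \<Longrightarrow> block j \<subseteq> {1..N}"
  using psum_mono[of j k n] psum_k by auto

lemma admissible_nonneg:
  assumes "admissible x" "i \<in> {1..N}"
  shows "0 \<le> x i"
proof -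
  obtain j where "j \<in> {1..k}" "i \<in> block j" using block_cover[OF assms(2)] .
  then show ?thesis using assms(1) a_nonneg[of j] unfolding admissible_def by force
qed

lemma exponent_nonneg:
  assumes "admissible x" "i \<in> {1..N}"
  shows "0 \<le> exponent x i"
  using admissible_nonneg[OF assms] assms(2) \<theta> unfolding exponent_def by simp

text \<open>The integers x i may coincide; the guaranteed gap comes from the label term (i - 1)
  \<theta>. Positivity of the interaction and distinctness of the positions both rest on this
  bound.\<close>

lemma exponent_gap:
  assumes "admissible x" "i \<in> {1..N}" "j \<in> {1..N}" "i < j"
  shows "\<theta> \<le> exponent x j - exponent x i"
proof -
  have "x i \<le> x j" using assms unfolding admissible_def by (auto intro: mono_onD)
  moreover have "1 * \<theta> \<le> (real j - real i) * \<theta>" using assms \<theta> by (intro mult_right_mono) auto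
  ultimately show ?thesis unfolding exponent_def by (simp add: algebra_simps)
qed

lemma exponent_in_block:
  assumes "admissible x" "i \<in> {1..N}"
  obtains j where "j \<in> {1..k}"
    "real_of_int (a j) + real (psum n (j - 1)) * \<theta> \<le> exponent x i"
    "exponent x i \<le> (real_of_int (b j) - 1) + (real (psum n j) - 1) * \<theta>"
proof -
  obtain j where j: "j \<in> {1..k}" "i \<in> block j" using block_cover[OF assms(2)] .
  then have "a j \<le> x i" "x i \<le> b j - 1" using assms(1) unfolding admissible_def by auto
  moreover have "real (psum n (j - 1)) * \<theta> \<le> (real i - 1) * \<theta>"
     "(real i - 1) * \<theta> \<le> (real (psum n j) - 1) * \<theta>"
    using j \<theta> by (auto intro!: mult_right_mono)
  ultimately show thesis using that[OF j(1)] j unfolding exponent_def by (auto simp: algebra_simps)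
qed

lemma config_apply: "i \<in> {1..N} \<Longrightarrow> config x i = L (exponent x i)"
  by (simp add: config_def)

lemma config_in_bands:
  assumes "l \<in> X" "i \<in> {1..N}"
  shows "l i \<in> bands q u \<theta> k n a b"
proof -
  obtain x where x: "admissible x" "l = config x" using assms(1) state_space_eq by auto
  obtain j where "j \<in> {1..k}"
    "real_of_int (a j) + real (psum n (j - 1)) * \<theta> \<le> exponent x i"
    "exponent x i \<le> (real_of_int (b j) - 1) + (real (psum n j) - 1) * \<theta>"
    using exponent_in_block[OF x(1) assms(2)] by metis
  then show ?thesis
    using a_nonneg[of j] \<theta> exponent_nonneg[OF x(1) assms(2)]
    unfolding bands_def alpha_def beta_minus_def x(2) config_apply[OF assms(2)]
    by (intro UN_I[of j]) (auto intro!: L_mono)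
qed

text \<open>An admissible x is unconstrained outside {1..N}, so finiteness is read off from its
  restriction, which gives the same configuration.\<close>

lemma finite_state_space: "finite X"
proof -
  define A where "A = (\<Union>j\<in>{1..k}. {a j..b j - 1})"
  have "X \<subseteq> config ` ({1..N} \<rightarrow>\<^sub>E A)"
  proof
    fix l assume "l \<in> X"
    then obtain x where x: "admissible x" "l = config x" using state_space_eq by auto
    have "restrict x {1..N} \<in> {1..N} \<rightarrow>\<^sub>E A"
    proof (rule restrict_PiE_iff[THEN iffD2], rule ballI)
      fix i assume "i \<in> {1..N}"
      then obtain j where "j \<in> {1..k}" "i \<in> block j" using block_cover by blast
      then show "x i \<in> A" using x(1) unfolding admissible_def A_def by force
    qed
    moreover have "l = config (restrict x {1..N})"
      unfolding x(2) config_def exponent_def by (intro restrict_ext) simp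
    ultimately show "l \<in> config ` ({1..N} \<rightarrow>\<^sub>E A)" by blast
  qed
  moreover have "finite ({1..N} \<rightarrow>\<^sub>E A)" by (intro finite_PiE) (auto simp: A_def)
  ultimately show ?thesis using finite_surj by blast
qed

lemma config_update:
  assumes "i \<in> {1..N}"
  shows "(config x)(i := L (exponent x i + real_of_int d)) = config (x(i := x i + d))"
  using assms by (auto simp: config_def exponent_def algebra_simps fun_eq_iff)

lemma mono_on_update:
  fixes x :: "nat \<Rightarrow> int"
  assumes "mono_on {1..N} x"
    and "\<And>j. j \<in> {1..N} \<Longrightarrow> j < i \<Longrightarrow> x j \<le> c" "\<And>j. j \<in> {1..N} \<Longrightarrow> i < j \<Longrightarrow> c \<le> x j"
  shows "mono_on {1..N} (x(i := c))"
  using assms by (auto intro!: mono_onI dest: mono_onD)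

text \<open>Lowering x i can fail in two ways. If x (i - 1) = x i, the left neighbour has exponent
  exactly s - \<theta>. If x i equals the lower bound a j, then either i is the first label of its
  block, the edge, or x (i - 1) is squeezed to a j as well and the particle is blocked
  again.\<close>

lemma decrement:
  assumes "l \<in> X" "i \<in> {1..N}" "0 \<le> s" "l i = L s"
  obtains (move) "1 \<le> s" "l(i := L (s - 1)) \<in> X"
    | (blocked) "i - 1 \<in> {1..N} - {i}" "l (i - 1) = L (s - \<theta>)"
    | (edge) j where "j \<in> {1..k}" "s = real_of_int (a j) + real (psum n (j - 1)) * \<theta>"
proof -
  obtain x where x: "admissible x" "l = config x" using assms(1) state_space_eq by auto
  have s: "s = exponent x i"
    using assms x config_apply L_eq_iff exponent_nonneg by metis
  have mono: "mono_on {1..N} x" using x(1) by (simp add: admissible_def)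
  have blocked': thesis if "i - 1 \<in> {1..N}" "x (i - 1) = x i"
  proof (rule blocked)
    have "real (i - 1) = real i - 1" using that(1) by (subst of_nat_diff) auto
    then show "l (i - 1) = L (s - \<theta>)"
      using that by (simp add: x(2) config_apply s exponent_def algebra_simps)
  qed (use that in auto)
  show thesis
  proof (cases "\<exists>j\<in>{1..k}. i \<in> block j \<and> x i = a j")
    case True
    then obtain j where j: "j \<in> {1..k}" "i \<in> block j" "x i = a j" by blast
    show thesis
    proof (cases "i = psum n (j - 1) + 1")
      case True
      show thesis by (rule edge[OF j(1)]) (use j(3) True in \<open>simp add: s exponent_def\<close>)
    next
      case False
      then have "i - 1 \<in> block j" using j(2) by auto
      moreover have "i - 1 \<in> {1..N}" using \<open>i - 1 \<in> block j\<close> block_subset[OF j(1)] by blast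
      moreover have "x (i - 1) \<le> x i" using \<open>i - 1 \<in> {1..N}\<close> assms(2) by (intro mono_onD[OF mono]) auto
      moreover have "a j \<le> x (i - 1)"
        using x(1) j(1) \<open>i - 1 \<in> block j\<close> unfolding admissible_def by blast
      ultimately have "x (i - 1) = x i" using j(3) by linarith
      then show thesis using blocked' \<open>i - 1 \<in> {1..N}\<close> by blast
    qed
  next
    case no_edge: False
    show thesis
    proof (cases "i - 1 \<in> {1..N} \<and> x (i - 1) = x i")
      case True
      then show thesis using blocked' by blast
    next
      case False
      have "admissible (x(i := x i - 1))"
        unfolding admissible_def
      proof (intro conjI ballI)
        show "mono_on {1..N} (x(i := x i - 1))"
        proof (rule mono_on_update[OF mono])
          fix j assume j: "j \<in> {1..N}" "j < i"
          then have "i - 1 \<in> {1..N}" using assms(2) by auto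
          then have "x j \<le> x (i - 1)" "x (i - 1) \<le> x i" "x (i - 1) \<noteq> x i"
            using j assms(2) False by (auto intro!: mono_onD[OF mono])
          then show "x j \<le> x i - 1" by linarith
        next
          fix j assume "j \<in> {1..N}" "i < j"
          then show "x i - 1 \<le> x j" using mono_onD[OF mono assms(2), of j] by simp
        qed
      next
        fix j i' assume j: "j \<in> {1..k}" "i' \<in> block j"
        then have "a j \<le> x i'" "x i' \<le> b j - 1" using x(1) unfolding admissible_def by auto
        moreover have "i' = i \<Longrightarrow> x i' \<noteq> a j" using no_edge j by auto
        ultimately show "a j \<le> (x(i := x i - 1)) i'" "(x(i := x i - 1)) i' \<le> b j - 1" by auto
      qed
      \<comment> \<open>The bound 1 \<le> s comes from the moved vector: it is admissible, hence
        still nonnegative.\<close>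
      moreover from this have "0 \<le> x i - 1" using admissible_nonneg assms(2) by fastforce
      then have "0 \<le> real_of_int (x i) - 1" "0 \<le> (real i - 1) * \<theta>" using assms(2) \<theta> by auto
      then have "1 \<le> s" unfolding s exponent_def by linarith
      moreover have "l(i := L (s - 1)) = config (x(i := x i - 1))"
        using config_update[OF assms(2), of x "-1"] unfolding x(2) s by simp
      ultimately show thesis using move state_space_eq by auto
    qed
  qed
qed

text \<open>Mirror image of \<open>decrement\<close>: the blocking neighbour has exponent s +
  \<theta>, and the edge is the last label of a block at its upper bound b j - 1.\<close>

lemma increment:
  assumes "l \<in> X" "i \<in> {1..N}" "0 \<le> s" "l i = L s"
  obtains (move) "l(i := L (s + 1)) \<in> X"
    | (blocked) "i + 1 \<in> {1..N} - {i}" "l (i + 1) = L (s + \<theta>)"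
    | (edge) j where "j \<in> {1..k}" "s = real_of_int (b j) - 1 + (real (psum n j) - 1) * \<theta>"
proof -
  obtain x where x: "admissible x" "l = config x" using assms(1) state_space_eq by auto
  have s: "s = exponent x i"
    using assms x config_apply L_eq_iff exponent_nonneg by metis
  have mono: "mono_on {1..N} x" using x(1) by (simp add: admissible_def)
  have blocked': thesis if "i + 1 \<in> {1..N}" "x (i + 1) = x i"
  proof (rule blocked)
    show "l (i + 1) = L (s + \<theta>)"
      using that by (simp add: x(2) config_apply s exponent_def algebra_simps)
  qed (use that in auto)
  show thesis
  proof (cases "\<exists>j\<in>{1..k}. i \<in> block j \<and> x i = b j - 1")
    case True
    then obtain j where j: "j \<in> {1..k}" "i \<in> block j" "x i = b j - 1" by blast
    show thesis
    proof (cases "i = psum n j")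
      case True
      show thesis by (rule edge[OF j(1)]) (use j(3) True in \<open>simp add: s exponent_def\<close>)
    next
      case False
      then have "i + 1 \<in> block j" using j(2) by auto
      moreover have "i + 1 \<in> {1..N}" using \<open>i + 1 \<in> block j\<close> block_subset[OF j(1)] by blast
      moreover have "x i \<le> x (i + 1)" using \<open>i + 1 \<in> {1..N}\<close> assms(2) by (intro mono_onD[OF mono]) auto
      moreover have "x (i + 1) \<le> b j - 1"
        using x(1) j(1) \<open>i + 1 \<in> block j\<close> unfolding admissible_def by blast
      ultimately have "x (i + 1) = x i" using j(3) by linarith
      then show thesis using blocked' \<open>i + 1 \<in> {1..N}\<close> by blast
    qed
  next
    case no_edge: False
    show thesis
    proof (cases "i + 1 \<in> {1..N} \<and> x (i + 1) = x i")
      case True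
      then show thesis using blocked' by blast
    next
      case False
      have "admissible (x(i := x i + 1))"
        unfolding admissible_def
      proof (intro conjI ballI)
        show "mono_on {1..N} (x(i := x i + 1))"
        proof (rule mono_on_update[OF mono])
          fix j assume j: "j \<in> {1..N}" "i < j"
          then have "i + 1 \<in> {1..N}" using assms(2) by auto
          then have "x (i + 1) \<le> x j" "x i \<le> x (i + 1)" "x (i + 1) \<noteq> x i"
            using j assms(2) False by (auto intro!: mono_onD[OF mono])
          then show "x i + 1 \<le> x j" by linarith
        next
          fix j assume "j \<in> {1..N}" "j < i"
          then show "x j \<le> x i + 1" using mono_onD[OF mono _ assms(2), of j] by simp
        qed
      next
        fix j i' assume j: "j \<in> {1..k}" "i' \<in> block j"
        then have "a j \<le> x i'" "x i' \<le> b j - 1" using x(1) unfolding admissible_def by auto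
        moreover have "i' = i \<Longrightarrow> x i' \<noteq> b j - 1" using no_edge j by auto
        ultimately show "a j \<le> (x(i := x i + 1)) i'" "(x(i := x i + 1)) i' \<le> b j - 1" by auto
      qed
      moreover have "l(i := L (s + 1)) = config (x(i := x i + 1))"
        using config_update[OF assms(2), of x 1] unfolding x(2) s by simp
      ultimately show thesis using move state_space_eq by auto
    qed
  qed
qed

section \<open>Weights under a one-particle move\<close>

lemma weight_pos:
  assumes "l \<in> X"
  shows "0 < weight q u \<theta> N w l"
proof -
  obtain x where x: "admissible x" "l = config x" using assms(1) state_space_eq by auto
  have "0 < interaction q u \<theta> (l i) (l j)" if "j \<in> {1..N}" "i \<in> {1..<j}" for i j
    using that x exponent_nonneg[OF x(1)] exponent_gap[OF x(1), of i j]
    by (auto simp: config_apply intro!: interaction_pos q u \<theta>)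
  then show ?thesis
    unfolding weight_def using w_pos config_in_bands[OF assms]
    by (auto intro!: mult_pos_pos prod_pos)
qed

text \<open>Pairs without i and the one-particle weights of the other labels agree on both sides.
  The cross-multiplied values of w balance the moving particle, and each pair containing i is
  settled by \<open>interaction_shift_left\<close> or
  \<open>interaction_shift_right\<close>.\<close>

lemma weight_shift:
  assumes "l \<in> X" "i \<in> {1..N}" "1 \<le> s" "l i = L s" "l(i := L (s - 1)) \<in> X"
  shows "weight q u \<theta> N w l * w (L (s - 1)) *
           (\<Prod>j\<in>{1..N}-{i}. (L (s - \<theta>) - l j) / (L s - l j)) =
         weight q u \<theta> N w (l(i := L (s - 1))) * w (L s) *
           (\<Prod>j\<in>{1..N}-{i}. (L (s - 1 + \<theta>) - l j) / (L (s - 1) - l j))"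
proof -
  define l' where "l' = l(i := L (s - 1))"
  define I where "I = interaction q u \<theta>"
  obtain x where x: "admissible x" "l = config x" using assms(1) state_space_eq by auto
  obtain x' where x': "admissible x'" "l' = config x'" 
    using assms(5) state_space_eq unfolding l'_def by auto
  have s: "s = exponent x i"
    using assms x config_apply L_eq_iff exponent_nonneg
    by (metis order_trans zero_le_one)
  have "l' i = L (s - 1)" by (simp add: l'_def)
  then have s': "s - 1 = exponent x' i"
    using assms x' config_apply L_eq_iff[of "s - 1" "exponent x' i"] exponent_nonneg by auto
  have xx: "exponent x j = exponent x' j" if "j \<in> {1..N} - {i}" for j
  proof -
    have "l j = l' j" using that by (simp add: l'_def)
    then show ?thesis using that x x' config_apply L_eq_iff exponent_nonneg by auto
  qed
  have *: "(if j < i then I (l j) (l i) else I (l i) (l j)) * ((L (s - \<theta>) - l j) / (L s - l j)) =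
      (if j < i then I (l' j) (l' i) else I (l' i) (l' j)) *
         ((L (s - 1 + \<theta>) - l j) / (L (s - 1) - l j))"
    if j: "j \<in> {1..N} - {i}" for j
  proof -
    define t where "t = exponent x j"
    have t: "l j = L t" "0 \<le> t" "l' j = L t"
      using j x(2) exponent_nonneg[OF x(1)] by (auto simp: t_def config_apply l'_def)
    have li: "l i = L s" "l' i = L (s - 1)" using assms by (auto simp: l'_def)
    show ?thesis
    proof (cases "j < i")
      case True
      \<comment> \<open>The gap is taken in the moved configuration, which supplies the additional
        unit.\<close>
      then have "\<theta> \<le> s - 1 - t"
        using exponent_gap[OF x'(1), of j i] j assms(2) xx[OF j] s' by (simp add: t_def)
      then show ?thesis using True t li interaction_shift_right[OF q u \<theta>, of t s]
        unfolding I_def by simp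
    next
      case False
      then have "\<theta> \<le> t - s"
        using exponent_gap[OF x(1), of i j] j assms(2) s by (simp add: t_def)
      then show ?thesis using False t li assms(3) interaction_shift_left[OF q u \<theta>, of s t]
        unfolding I_def by simp
    qed
  qed
  define C where "C l = (\<Prod>j\<in>{1..N}-{i}. \<Prod>p\<in>{1..<j}-{i}. I (l p) (l j))" for l
  define V where "V l = (\<Prod>j\<in>{1..N}-{i}. w (l j))" for l
  define J where "J l = (\<Prod>j\<in>{1..N}-{i}. if j < i then I (l j) (l i) else I (l i) (l j))" for l
  have W: "weight q u \<theta> N w m = C m * J m * (w (m i) * V m)" for m
    unfolding weight_def C_def V_def J_def I_def
    using assms(2) prod_pairs_split[OF assms(2), of "\<lambda>p j. interaction q u \<theta> (m p) (m j)"]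
      prod.remove[of "{1..N}" i "\<lambda>i. w (m i)"] by simp
  have "C l = C l'" unfolding C_def by (intro prod.cong) (auto simp: l'_def)
  moreover have "V l = V l'" unfolding V_def by (intro prod.cong) (auto simp: l'_def)
  moreover have "l i = L s" "l' i = L (s - 1)" using assms by (auto simp: l'_def)
  moreover have "J l * (\<Prod>j\<in>{1..N}-{i}. (L (s - \<theta>) - l j) / (L s - l j)) =
     J l' * (\<Prod>j\<in>{1..N}-{i}. (L (s - 1 + \<theta>) - l j) / (L (s - 1) - l j))"
    unfolding J_def prod.distrib[symmetric] using * by (intro prod.cong) auto
  ultimately show ?thesis unfolding l'_def[symmetric] W by (simp add: mult_ac)
qed

end

section \<open>Cancellation of residues\<close>

text \<open>Injectivity of l allows at most one singular factor, so the pole is at most simple.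
  Writing the limit as a sum over matching indices, with at most one term, covers the regular and
  the singular case together and permits interchanging sums later.\<close>

lemma tendsto_simple_pole_prod:
  fixes A S :: "complex \<Rightarrow> complex" and l :: "'i \<Rightarrow> complex"
  assumes "finite I" "inj_on l I" "isCont A z0" "(S has_field_derivative D) (at z0)"
    and D: "\<And>i. i \<in> I \<Longrightarrow> l i = S z0 \<Longrightarrow> D \<noteq> 0"
  shows "((\<lambda>z. (z - z0) * (\<Prod>i\<in>I. (A z - l i) / (S z - l i))) \<longlongrightarrow>
    (\<Sum>i | i \<in> I \<and> l i = S z0. (A z0 - l i) / D * (\<Prod>j\<in>I-{i}. (A z0 - l j) / (S z0 - l j)))) (at z0)"
proof -
  have A: "A \<midarrow>z0\<rightarrow> A z0" using assms(3) by (simp add: isCont_def)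
  have S: "S \<midarrow>z0\<rightarrow> S z0" using DERIV_isCont[OF assms(4)] by (simp add: isCont_def)
  have P: "((\<lambda>z. \<Prod>j\<in>J. (A z - l j) / (S z - l j)) \<longlongrightarrow> (\<Prod>j\<in>J. (A z0 - l j) / (S z0 - l j))) (at z0)"
    if "\<And>j. j \<in> J \<Longrightarrow> S z0 \<noteq> l j" for J
    by (intro tendsto_prod tendsto_divide tendsto_diff A S tendsto_const) (use that in auto)
  show ?thesis
  proof (cases "\<exists>i\<in>I. l i = S z0")
    case True
    then obtain i where i: "i \<in> I" "l i = S z0" by auto
    have uniq: "j = i" if "j \<in> I" "l j = S z0" for j
      using inj_onD[OF assms(2)] that i by metis
    have ne: "S z0 \<noteq> l j" if "j \<in> I - {i}" for j using uniq[of j] that by force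
    have sing: "{j. j \<in> I \<and> l j = S z0} = {i}" using i uniq by blast
    have SD: "((\<lambda>z. (S z - S z0) / (z - z0)) \<longlongrightarrow> D) (at z0)"
      using assms(4) by (simp add: has_field_derivative_iff)
    have "((\<lambda>z. (A z - l i) / ((S z - S z0) / (z - z0)) *
          (\<Prod>j\<in>I-{i}. (A z - l j) / (S z - l j)))
        \<longlongrightarrow> (A z0 - l i) / D * (\<Prod>j\<in>I-{i}. (A z0 - l j) / (S z0 - l j))) (at z0)"
      by (rule tendsto_mult[OF tendsto_divide[OF tendsto_diff[OF A tendsto_const] SD D[OF i]] P[OF ne]])
    \<comment> \<open>An equality of functions at every z, including z0 and other zeros of the
      denominator, because division by zero returns 0 on both sides.\<close>
    moreover have "(\<lambda>z. (A z - l i) / ((S z - S z0) / (z - z0)) *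
          (\<Prod>j\<in>I-{i}. (A z - l j) / (S z - l j)))
        = (\<lambda>z. (z - z0) * (\<Prod>i\<in>I. (A z - l i) / (S z - l i)))"
      using i(2) by (simp add: prod.remove[OF assms(1) i(1)] mult_ac fun_eq_iff)
    ultimately show ?thesis unfolding sing by simp
  next
    case False
    then have "{i. i \<in> I \<and> l i = S z0} = {}" by auto
    moreover have "((\<lambda>z. (z - z0) * (\<Prod>i\<in>I. (A z - l i) / (S z - l i))) \<longlongrightarrow>
        (z0 - z0) * (\<Prod>j\<in>I. (A z0 - l j) / (S z0 - l j))) (at z0)"
      using False by (intro tendsto_mult tendsto_diff P tendsto_ident_at tendsto_const) auto
    ultimately show ?thesis by (simp only: sum.empty) simp
  qed
qed

lemma sigma_has_derivative:
  assumes "z \<noteq> 0" "c \<noteq> 0"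
  shows "((\<lambda>z. sigma u (c * z)) has_field_derivative (c - of_real u / (c * z\<^sup>2))) (at z)"
proof -
  have "((\<lambda>z. c * z + of_real u / (c * z)) has_field_derivative
      c * 1 + (0 * (c * z) - of_real u * (c * 1)) / ((c * z) * (c * z))) (at z)"
    by (intro DERIV_add DERIV_cmult DERIV_ident DERIV_divide DERIV_const) (use assms in auto)
  moreover have "c * 1 + (0 * (c * z) - of_real u * (c * 1)) / ((c * z) * (c * z))
      = c - of_real u / (c * z\<^sup>2)"
    using assms by (simp add: power2_eq_square)
  ultimately show ?thesis unfolding sigma_def by (simp only:)
qed

section \<open>Fibres of sigma over the lattice\<close>

lemma sigma_lattice:
  "sigma u (of_real (q powr (- s))) = of_real (quad_lattice q u s)"
proof -
  have "u / q powr (- s) = u * q powr s" by (simp add: powr_minus divide_inverse)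
  then show ?thesis
    unfolding sigma_def quad_lattice_def by (metis of_real_add of_real_divide)
qed

text \<open>For u \<noteq> 0 the map sigma is invariant under z to u / z, so q^(-s) has the
  companion preimage u q^s.\<close>

lemma sigma_lattice':
  assumes "u \<noteq> 0"
  shows "sigma u (of_real (u * q powr s)) = of_real (quad_lattice q u s)"
proof -
  have "u / (u * q powr s) = q powr (- s)" using assms by (simp add: powr_minus divide_inverse)
  then show ?thesis
    unfolding sigma_def quad_lattice_def by (metis add.commute of_real_add of_real_divide)
qed

lemma quad_lattice_pos: "0 < q \<Longrightarrow> 0 \<le> u \<Longrightarrow> 0 < quad_lattice q u s"
  unfolding quad_lattice_def by (simp add: add_pos_nonneg)

text \<open>Multiplication by z turns the equation into a monic quadratic with roots q^(-s) and u
  q^s.\<close>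

lemma sigma_eq_lattice:
  assumes "0 < q" "0 \<le> u" "sigma u z = of_real (quad_lattice q u s)"
  shows "z = of_real (q powr (- s)) \<or> (u \<noteq> 0 \<and> z = of_real (u * q powr s))"
proof -
  have "quad_lattice q u s \<noteq> 0" using quad_lattice_pos[OF assms(1,2), of s] by simp
  \<comment> \<open>With total division sigma takes the value 0 at the origin, while lattice values
    are positive.\<close>
  then have z: "z \<noteq> 0" using assms(3) by (auto simp: sigma_def)
  have "of_real (q powr (- s)) * of_real (q powr s) = (1::complex)"
    using assms(1) by (simp add: of_real_mult[symmetric] powr_minus del: of_real_mult)
  moreover have "(z - c) * (z - v * d) = z * (z + v / z - (c + v * d))" if "c * d = 1" for c d v :: complex
  proof -
    have "z * (z + v / z - (c + v * d)) = z * z + v - z * (c + v * d)"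
      using z by (simp add: algebra_simps)
    moreover have "(z - c) * (z - v * d) = z * z + v * (c * d) - z * (c + v * d)"
      by (simp add: algebra_simps)
    ultimately show ?thesis using that by simp
  qed
  ultimately have "(z - of_real (q powr (- s))) * (z - of_real u * of_real (q powr s))
      = z * (sigma u z - of_real (quad_lattice q u s))"
    unfolding sigma_def quad_lattice_def of_real_add of_real_mult by blast
  then have "z = of_real (q powr (- s)) \<or> z = of_real (u * q powr s)"
    unfolding assms(3) by simp
  moreover have "u = 0 \<Longrightarrow> z \<noteq> of_real (u * q powr s)" using z by simp
  ultimately show ?thesis by blast
qed

text \<open>Explains the rational factor of the weight ratio condition, with Q = q, T = q^\<theta>,
  U = u. Both quotients contain (T - 1) / T * z, with opposite signs; the remaining factors are (T
  z^2 - U) / (z^2 - U) and (Q^2 z^2 - U T) / (Q^2 z^2 - U), whose ratio is the one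
  prescribed.\<close>

lemma residue_prefactors:
  fixes z Q T U wx wy m p :: complex
  assumes "z \<noteq> 0" "Q \<noteq> 0" "T \<noteq> 0" "z\<^sup>2 \<noteq> U" "Q\<^sup>2 * z\<^sup>2 \<noteq> U"
    and "wx * ((T * z\<^sup>2 - U) * (Q\<^sup>2 * z\<^sup>2 - U) * m) = wy * ((Q\<^sup>2 * z\<^sup>2 - U * T) * (z\<^sup>2 - U) * p)"
  shows "wx * m * (((T * z + U / (T * z)) - (z + U / z)) / (1 - U / z\<^sup>2)) +
    wy * p * (((Q / T * z + U / (Q / T * z)) - (Q * z + U / (Q * z))) / (Q - U / (Q * z\<^sup>2))) = 0"
proof -
  have nz: "z\<^sup>2 - U \<noteq> 0" "Q\<^sup>2 * z\<^sup>2 - U \<noteq> 0" using assms by auto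
  have 1: "((T * z + U / (T * z)) - (z + U / z)) / (1 - U / z\<^sup>2)
     = (T - 1) / T * z * ((T * z\<^sup>2 - U) / (z\<^sup>2 - U))"
  proof -
    have "(T * z + U / (T * z)) - (z + U / z) = (T - 1) / T * (T * z\<^sup>2 - U) / z"
      "1 - U / z\<^sup>2 = (z\<^sup>2 - U) / z\<^sup>2"
      using assms(1,3) by (simp_all add: field_simps power2_eq_square)
    then show ?thesis using assms(1,3) nz by (simp add: divide_simps power2_eq_square)
  qed
  have 2: "((Q / T * z + U / (Q / T * z)) - (Q * z + U / (Q * z))) / (Q - U / (Q * z\<^sup>2))
     = - ((T - 1) / T * z * ((Q\<^sup>2 * z\<^sup>2 - U * T) / (Q\<^sup>2 * z\<^sup>2 - U)))"
  proof -
    have num: "(Q / T * z + U / (Q / T * z)) - (Q * z + U / (Q * z))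
        = - ((T - 1) / T * (Q\<^sup>2 * z\<^sup>2 - U * T) / (Q * z))"
      and den: "Q - U / (Q * z\<^sup>2) = (Q\<^sup>2 * z\<^sup>2 - U) / (Q * z\<^sup>2)"
      using assms(1-3) by (simp_all add: field_simps power2_eq_square)
    have "- (c * m / (Q * z)) / (d / (Q * z\<^sup>2)) = - (c * z * (m / d))" if "d \<noteq> 0" for c m d
      using assms(1,2) that by (simp add: field_simps power2_eq_square)
    from this[OF nz(2)] show ?thesis unfolding num den .
  qed
  have eq: "wx * m * ((T * z\<^sup>2 - U) / (z\<^sup>2 - U)) = wy * p * ((Q\<^sup>2 * z\<^sup>2 - U * T) / (Q\<^sup>2 * z\<^sup>2 - U))"
    using assms(6) nz by (simp add: frac_eq_eq mult_ac)
  have dist: "c * (e * f) + d * (- (e * g)) = e * (c * f - d * g)" for c d e f g :: complex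
    by (simp add: algebra_simps)
  show ?thesis unfolding 1 2 dist eq by simp
qed

section \<open>Residues summed over configurations\<close>

context quadratic_ensemble
begin

text \<open>The move of particle i is a bijection between the configurations at s that can be
  lowered and those at s - 1 that can be raised; all others contribute 0. F and G stay generic
  because the two expectations exchange roles between the two kinds of poles.\<close>

lemma sum_shift_cancel:
  fixes F G :: "(nat \<Rightarrow> real) \<Rightarrow> complex"
  assumes FG: "\<And>l. l \<in> X \<Longrightarrow> l i = L s \<Longrightarrow> l(i := L (s - 1)) \<in> X \<Longrightarrow> F l + G (l(i := L (s - 1))) = 0"
    and F0: "\<And>l. l \<in> X \<Longrightarrow> l i = L s \<Longrightarrow> l(i := L (s - 1)) \<notin> X \<Longrightarrow> F l = 0"
    and G0: "\<And>l. l \<in> X \<Longrightarrow> l i = L (s - 1) \<Longrightarrow> l(i := L s) \<notin> X \<Longrightarrow> G l = 0"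
  shows "(\<Sum>l | l \<in> X \<and> l i = L s. F l) + (\<Sum>l | l \<in> X \<and> l i = L (s - 1). G l) = 0"
proof -
  let ?U = "{l \<in> X. l i = L s \<and> l(i := L (s - 1)) \<in> X}"
  let ?V = "{l \<in> X. l i = L (s - 1) \<and> l(i := L s) \<in> X}"
  have "(\<Sum>l | l \<in> X \<and> l i = L s. F l) = sum F ?U"
    by (rule sum.mono_neutral_right) (use finite_state_space F0 in auto)
  moreover have "(\<Sum>l | l \<in> X \<and> l i = L (s - 1). G l) = sum G ?V"
    by (rule sum.mono_neutral_right) (use finite_state_space G0 in auto)
  moreover have "sum G ?V = (\<Sum>l\<in>?U. G (l(i := L (s - 1))))"
    by (rule sum.reindex_bij_witness[of _ "\<lambda>l. l(i := L (s - 1))" "\<lambda>l. l(i := L s)"])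
       (auto simp: fun_upd_idem)
  ultimately show ?thesis using FG by (simp add: sum.distrib[symmetric])
qed

text \<open>When l i = sigma u z, this is the residue at z of the product in the first expectation:
  1 - u / z^2 is the derivative of sigma there. In \<open>residue2\<close> the divisor is the
  derivative of z to sigma(q z).\<close>

definition residue1 :: "complex \<Rightarrow> (nat \<Rightarrow> real) \<Rightarrow> nat \<Rightarrow> complex" where
  "residue1 z l i = (sigma u (of_real (q powr \<theta>) * z) - of_real (l i)) / (1 - of_real u / z\<^sup>2) *
     (\<Prod>j\<in>{1..N}-{i}. (sigma u (of_real (q powr \<theta>) * z) - of_real (l j)) / (sigma u z - of_real (l j)))"

definition residue2 :: "complex \<Rightarrow> (nat \<Rightarrow> real) \<Rightarrow> nat \<Rightarrow> complex" where
  "residue2 z l i = (sigma u (of_real (q powr (1 - \<theta>)) * z) - of_real (l i)) /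
       (of_real q - of_real u / (of_real q * z\<^sup>2)) *
     (\<Prod>j\<in>{1..N}-{i}. (sigma u (of_real (q powr (1 - \<theta>)) * z) - of_real (l j)) /
                       (sigma u (of_real q * z) - of_real (l j)))"

text \<open>After multiplication by wx * wy the sum factors as the hypothesis on the prefactors E1,
  E2 times a common term. P1 and P2 stand for the products over the other particles.\<close>

lemma pair_cancel:
  fixes W W' wx wy m p E1 E2 P1 P2 :: complex
  assumes "wx \<noteq> 0" "wy \<noteq> 0" "wx * m * E1 + wy * p * E2 = 0" "W * wy * P1 = W' * wx * P2"
  shows "m * (W * (E1 * P1)) + p * (W' * (E2 * P2)) = 0"
proof -
  have "wx * wy * (m * (W * (E1 * P1)) + p * (W' * (E2 * P2)))
      = (wx * m * E1) * (W * wy * P1) + (wy * p * E2) * (W' * wx * P2)"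
    by (simp add: algebra_simps)
  also have "\<dots> = (wx * m * E1 + wy * p * E2) * (W * wy * P1)"
    unfolding assms(4) by (simp add: algebra_simps)
  also have "\<dots> = 0" using assms(3) by simp
  finally show ?thesis using assms(1,2) by simp
qed

lemma lattice_powr: "of_real (q powr c) * of_real (q powr d) = (of_real (q powr (c + d)) :: complex)"
  by (simp add: powr_add)

text \<open>Joins the one-particle prefactors to the relation for the rest of the weight. It is
  stated for arbitrary x and y, since x = L s, y = L (s - 1) at z = q^(-s), whereas x = L (s - 1), y
  = L s at z = u q^(s-1).\<close>

lemma residues_cancel_pair:
  assumes i: "i \<in> {1..N}" and x: "x \<in> bands q u \<theta> k n a b" and y: "y \<in> bands q u \<theta> k n a b"
    and z: "z \<noteq> 0" "z\<^sup>2 \<noteq> of_real u" "of_real (q\<^sup>2) * z\<^sup>2 \<noteq> of_real u"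
    and xy: "sigma u z = of_real x" "sigma u (of_real q * z) = of_real y"
    and ratio: "weight_ratio_condition q u \<theta> (bands q u \<theta> k n a b) w {z} \<Phi>p \<Phi>m"
    and l: "l i = x" "l' = l(i := y)"
    and s: "sigma u (of_real (q powr \<theta>) * z) = of_real s"
           "sigma u (of_real (q powr (1 - \<theta>)) * z) = of_real t"
    and W: "weight q u \<theta> N w l * w y * (\<Prod>j\<in>{1..N}-{i}. (s - l j) / (x - l j)) =
      weight q u \<theta> N w l' * w x * (\<Prod>j\<in>{1..N}-{i}. (t - l j) / (y - l j))"
  shows "\<Phi>m z * (of_real (weight q u \<theta> N w l) * residue1 z l i) +
    \<Phi>p z * (of_real (weight q u \<theta> N w l') * residue2 z l' i) = 0"
proof -
  let ?T = "of_real (q powr \<theta>) :: complex" and ?Q = "of_real q :: complex"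
  have Tq: "of_real (q powr (1 - \<theta>)) = ?Q / ?T" using q by (simp add: powr_diff)
  have P2: "(\<Prod>j\<in>{1..N}-{i}. (t - l j) / (y - l j)) = (\<Prod>j\<in>{1..N}-{i}. (t - l' j) / (y - l' j))"
    using l(2) by (intro prod.cong) auto
  have pref: "of_real (w x) * \<Phi>m z * (((?T * z + of_real u / (?T * z)) - (z + of_real u / z)) / (1 - of_real u / z\<^sup>2)) +
    of_real (w y) * \<Phi>p z * (((?Q / ?T * z + of_real u / (?Q / ?T * z)) - (?Q * z + of_real u / (?Q * z))) /
      (?Q - of_real u / (?Q * z\<^sup>2))) = 0"
  proof (rule residue_prefactors)
    show "of_real (w x) * ((?T * z\<^sup>2 - of_real u) * (?Q\<^sup>2 * z\<^sup>2 - of_real u) * \<Phi>m z) =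
      of_real (w y) * ((?Q\<^sup>2 * z\<^sup>2 - of_real u * ?T) * (z\<^sup>2 - of_real u) * \<Phi>p z)"
      using ratio x y xy unfolding weight_ratio_condition_def of_real_mult of_real_power by blast
    show "?Q\<^sup>2 * z\<^sup>2 \<noteq> of_real u" using z(3) by (simp only: of_real_power not_False_eq_True)
  qed (use z q in simp_all)
  have "\<Phi>m z * (of_real (weight q u \<theta> N w l) *
           ((sigma u (?T * z) - sigma u z) / (1 - of_real u / z\<^sup>2) *
             of_real (\<Prod>j\<in>{1..N}-{i}. (s - l j) / (x - l j)))) +
        \<Phi>p z * (of_real (weight q u \<theta> N w l') *
           ((sigma u (?Q / ?T * z) - sigma u (?Q * z)) / (?Q - of_real u / (?Q * z\<^sup>2)) *
             of_real (\<Prod>j\<in>{1..N}-{i}. (t - l' j) / (y - l' j)))) = 0"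
  proof (rule pair_cancel[where wx = "of_real (w x)" and wy = "of_real (w y)"])
    show "complex_of_real (weight q u \<theta> N w l) * complex_of_real (w y) *
        complex_of_real (\<Prod>j\<in>{1..N} - {i}. (s - l j) / (x - l j)) =
        complex_of_real (weight q u \<theta> N w l') * complex_of_real (w x) *
        complex_of_real (\<Prod>j\<in>{1..N} - {i}. (t - l' j) / (y - l' j))"
      using W unfolding P2 of_real_mult[symmetric] by simp
    show "of_real (w x) * \<Phi>m z * ((sigma u (?T * z) - sigma u z) / (1 - of_real u / z\<^sup>2)) +
      of_real (w y) * \<Phi>p z * ((sigma u (?Q / ?T * z) - sigma u (?Q * z)) /
        (?Q - of_real u / (?Q * z\<^sup>2))) = 0"
      using pref unfolding sigma_def .
  qed (use w_pos[OF x] w_pos[OF y] in simp_all)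
  moreover have "residue1 z l i = (sigma u (?T * z) - sigma u z) / (1 - of_real u / z\<^sup>2) *
      of_real (\<Prod>j\<in>{1..N}-{i}. (s - l j) / (x - l j))"
    unfolding residue1_def s(1) xy(1) l(1) by simp
  moreover have "residue2 z l' i = (sigma u (?Q / ?T * z) - sigma u (?Q * z)) / (?Q - of_real u / (?Q * z\<^sup>2)) *
      of_real (\<Prod>j\<in>{1..N}-{i}. (t - l' j) / (y - l' j))"
  proof -
    have "l' i = y" by (simp add: l(2))
    then show ?thesis unfolding residue2_def Tq[symmetric] s(2) xy(2) by simp
  qed
  ultimately show ?thesis by (simp only:)
qed

text \<open>A particle sitting at the shifted point makes a numerator vanish. This happens for the
  left neighbour at s - \<theta> when z = q^(-s), and for the right neighbour at s + \<theta> when z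
  = u q^s.\<close>

lemma residue1_blocked:
  assumes "j \<in> {1..N} - {i}" "sigma u (of_real (q powr \<theta>) * z) = of_real (l j)"
  shows "residue1 z l i = 0"
  unfolding residue1_def using assms by (subst prod_zero) auto

lemma residue2_blocked:
  assumes "j \<in> {1..N} - {i}" "sigma u (of_real (q powr (1 - \<theta>)) * z) = of_real (l j)"
  shows "residue2 z l i = 0"
  unfolding residue2_def using assms by (subst prod_zero) auto

lemma residues_cancel:
  fixes z :: complex
  assumes i: "i \<in> {1..N}"
    and ratio: "weight_ratio_condition q u \<theta> (bands q u \<theta> k n a b) w {z} \<Phi>p \<Phi>m"
    and p1: "\<And>j. j \<in> {1..k} \<Longrightarrow> z = of_real (q powr (- real_of_int (b j) - (real (psum n j) - 1) * \<theta>)) \<Longrightarrow> \<Phi>p z = 0"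
    and m1: "\<And>j. j \<in> {1..k} \<Longrightarrow> z = of_real (q powr (- real_of_int (a j) - real (psum n (j - 1)) * \<theta>)) \<Longrightarrow> \<Phi>m z = 0"
    and p2: "\<And>j. j \<in> {1..k} \<Longrightarrow> z = of_real (u * q powr (real_of_int (a j) - 1 + real (psum n (j - 1)) * \<theta>)) \<Longrightarrow> \<Phi>p z = 0"
    and m2: "\<And>j. j \<in> {1..k} \<Longrightarrow> z = of_real (u * q powr (real_of_int (b j) - 1 + (real (psum n j) - 1) * \<theta>)) \<Longrightarrow> \<Phi>m z = 0"
  defines "W \<equiv> \<lambda>l. complex_of_real (weight q u \<theta> N w l)"
  shows "\<Phi>m z * (\<Sum>l | l \<in> X \<and> of_real (l i) = sigma u z. W l * residue1 z l i) +
    \<Phi>p z * (\<Sum>l | l \<in> X \<and> of_real (l i) = sigma u (of_real q * z). W l * residue2 z l i) = 0"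
proof -
  let ?F1 = "\<lambda>l. \<Phi>m z * (W l * residue1 z l i)" and ?F2 = "\<lambda>l. \<Phi>p z * (W l * residue2 z l i)"
  have u_q_powr: "u * q powr e < 1" if "0 \<le> e" for e
    using u_powr_less_1[OF q u that] .
  have nz: "of_real c \<noteq> (of_real u :: complex)" if "c \<noteq> u" for c using that by simp
  have qpow: "1 \<le> q powr e" if "e \<le> 0" for e
    using powr_mono'[of e 0 q] q that by simp
  have sumF: "\<Phi>m z * (\<Sum>l\<in>Y. W l * residue1 z l i) = sum ?F1 Y"
             "\<Phi>p z * (\<Sum>l\<in>Y. W l * residue2 z l i) = sum ?F2 Y" for Y
    by (simp_all add: sum_distrib_left)
  \<comment> \<open>The thresholds ensure that both exponents linked by a move are nonnegative, with
    t = s - 1 on the second branch. In case \<open>N\<close> no pairing takes place.\<close>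
  consider (A) s where "1 \<le> s" "z = of_real (q powr (- s))"
    | (B) t where "0 \<le> t" "u \<noteq> 0" "z = of_real (u * q powr t)"
    | (N) "\<And>s. 1 \<le> s \<Longrightarrow> z \<noteq> of_real (q powr (- s))"
          "\<And>t. 0 \<le> t \<Longrightarrow> u \<noteq> 0 \<Longrightarrow> z \<noteq> of_real (u * q powr t)" by blast
  then show ?thesis
  proof cases
    case A
    have sig: "sigma u (of_real (q powr c) * z) = of_real (L (s - c))" for c
      using sigma_lattice[of u q "s - c"] unfolding A(2) lattice_powr by simp
    have xy: "sigma u z = of_real (L s)" "sigma u (of_real q * z) = of_real (L (s - 1))"
      using sig[of 0] sig[of 1] q by auto
    \<comment> \<open>Since 1 \<le> s, both exponents are nonpositive, so both squares are at least
      1 and exceed u: neither derivative vanishes.\<close>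
    have z2: "z\<^sup>2 = of_real (q powr (- 2 * s))" "of_real (q\<^sup>2) * z\<^sup>2 = of_real (q powr (2 - 2 * s))"
      unfolding A(2) power2_eq_square of_real_mult using q
      by (simp_all add: of_real_mult[symmetric] powr_add[symmetric] powr_mult_base del: of_real_mult)
         (simp add: powr_diff powr_minus field_simps power2_eq_square)
    have z: "z \<noteq> 0" "z\<^sup>2 \<noteq> of_real u" "of_real (q\<^sup>2) * z\<^sup>2 \<noteq> of_real u"
    proof -
      show "z \<noteq> 0" using A q by simp
      show "z\<^sup>2 \<noteq> of_real u"
        unfolding z2(1) by (rule nz) (use A(1) u qpow[of "- 2 * s"] in simp)
      show "of_real (q\<^sup>2) * z\<^sup>2 \<noteq> of_real u"
        unfolding z2(2) by (rule nz) (use A(1) u qpow[of "2 - 2 * s"] in simp)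
    qed
    have "sum ?F1 {l. l \<in> X \<and> l i = L s} + sum ?F2 {l. l \<in> X \<and> l i = L (s - 1)} = 0"
    proof (rule sum_shift_cancel)
      fix l assume l: "l \<in> X" "l i = L s" "l(i := L (s - 1)) \<in> X"
      show "?F1 l + ?F2 (l(i := L (s - 1))) = 0"
        unfolding W_def
      proof (rule residues_cancel_pair[where i = i and l = l and l' = "l(i := L (s - 1))" and
              z = z and \<Phi>p = \<Phi>p and \<Phi>m = \<Phi>m,
            OF i _ _ z xy ratio l(2) refl sig[of \<theta>] sig[of "1 - \<theta>"]])
        show "L s \<in> bands q u \<theta> k n a b" "L (s - 1) \<in> bands q u \<theta> k n a b"
          using config_in_bands[OF l(1) i] config_in_bands[OF l(3) i] l(2) by auto
        show "weight q u \<theta> N w l * w (L (s - 1)) *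
           (\<Prod>j\<in>{1..N}-{i}. (L (s - \<theta>) - l j) / (L s - l j)) =
         weight q u \<theta> N w (l(i := L (s - 1))) * w (L s) *
           (\<Prod>j\<in>{1..N}-{i}. (L (s - (1 - \<theta>)) - l j) / (L (s - 1) - l j))"
          using weight_shift[OF l(1) i A(1) l(2,3)] by (simp add: algebra_simps)
      qed
    next
      fix l assume l: "l \<in> X" "l i = L s" "l(i := L (s - 1)) \<notin> X"
      have s0: "0 \<le> s" using A(1) by simp
      from l(1) i s0 l(2) show "?F1 l = 0"
      proof (cases rule: decrement)
        case move
        then show ?thesis using l by simp
      next
        case blocked
        then show ?thesis using residue1_blocked[of "i - 1" i z l] sig[of \<theta>] by simp
      next
        case (edge j)
        then show ?thesis using m1[of j] A(2) by (simp add: algebra_simps)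
      qed
    next
      fix l assume l: "l \<in> X" "l i = L (s - 1)" "l(i := L s) \<notin> X"
      have s0: "0 \<le> s - 1" using A(1) by simp
      from l(1) i s0 l(2) show "?F2 l = 0"
      proof (cases rule: increment)
        case move
        then show ?thesis using l by simp
      next
        case blocked
        then show ?thesis using residue2_blocked[of "i + 1" i z l] sig[of "1 - \<theta>"]
          by (simp add: algebra_simps)
      next
        case (edge j)
        have "- s = - real_of_int (b j) - (real (psum n j) - 1) * \<theta>"
          using edge(2) by (simp add: algebra_simps)
        then show ?thesis using p1[OF edge(1)] A(2) by simp
      qed
    qed
    then show ?thesis unfolding sumF xy by simp
  next
    case B
    \<comment> \<open>On this branch multiplication by q raises the exponent, so the second
      expectation sees t + 1 and the first sees t; F2 and F1 therefore enter in exchanged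
      roles.\<close>
    define s where "s = t + 1"
    have u_pos: "0 < u" using B(2) u by simp
    have sig: "sigma u (of_real (q powr c) * z) = of_real (L (t + c))" for c
      using sigma_lattice'[OF B(2), of q "t + c"] unfolding B(3)
      by (simp add: powr_add mult_ac)
    have xy: "sigma u z = of_real (L (s - 1))" "sigma u (of_real q * z) = of_real (L s)"
      using sig[of 0] sig[of 1] q by (auto simp: s_def)
    have z2: "z\<^sup>2 = of_real (u * (u * q powr (2 * t)))"
        "of_real (q\<^sup>2) * z\<^sup>2 = of_real (u * (u * q powr (2 + 2 * t)))"
    proof -
      have sq: "q powr t * q powr t = q powr (2 * t)" by (simp flip: powr_add)
      have "(u * q powr t)\<^sup>2 = u * (u * q powr (2 * t))"
        unfolding sq[symmetric] power2_eq_square by (simp add: mult_ac)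
      then show "z\<^sup>2 = of_real (u * (u * q powr (2 * t)))"
        unfolding B(3) of_real_power[symmetric] by (rule arg_cong)
      have "q\<^sup>2 * (u * q powr t)\<^sup>2 = u * (u * q powr (2 + 2 * t))"
        unfolding powr_add sq[symmetric] power2_eq_square using q
        by (simp add: mult_ac power2_eq_square)
      then show "of_real (q\<^sup>2) * z\<^sup>2 = of_real (u * (u * q powr (2 + 2 * t)))"
        unfolding B(3) of_real_power[symmetric] of_real_mult[symmetric] by (rule arg_cong)
    qed
    have z: "z \<noteq> 0" "z\<^sup>2 \<noteq> of_real u" "of_real (q\<^sup>2) * z\<^sup>2 \<noteq> of_real u"
    proof -
      show "z \<noteq> 0" using B q by simp
      have *: "u * (u * q powr e) \<noteq> u" if "0 \<le> e" for e using u_q_powr[OF that] u_pos by simp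
      show "z\<^sup>2 \<noteq> of_real u"
        unfolding z2(1) by (rule nz, rule *) (use B(1) in simp)
      show "of_real (q\<^sup>2) * z\<^sup>2 \<noteq> of_real u"
        unfolding z2(2) by (rule nz, rule *) (use B(1) in simp)
    qed
    have "sum ?F2 {l. l \<in> X \<and> l i = L s} + sum ?F1 {l. l \<in> X \<and> l i = L (s - 1)} = 0"
    proof (rule sum_shift_cancel)
      fix l assume l: "l \<in> X" "l i = L s" "l(i := L (s - 1)) \<in> X"
      have "?F1 (l(i := L (s - 1))) + ?F2 l = 0"
        unfolding W_def
      proof (rule residues_cancel_pair[where i = i and l = "l(i := L (s - 1))" and l' = l and
              z = z and \<Phi>p = \<Phi>p and \<Phi>m = \<Phi>m,
            OF i _ _ z xy ratio _ _ sig[of \<theta>] sig[of "1 - \<theta>"]])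
        show "L s \<in> bands q u \<theta> k n a b" "L (s - 1) \<in> bands q u \<theta> k n a b"
          using config_in_bands[OF l(1) i] config_in_bands[OF l(3) i] l(2) by auto
        have "1 \<le> s" using B by (simp add: s_def)
        from weight_shift[OF l(1) i this l(2,3)]
        show "weight q u \<theta> N w (l(i := L (s - 1))) * w (L s) *
           (\<Prod>j\<in>{1..N}-{i}. (L (t + \<theta>) - (l(i := L (s - 1))) j) / (L (s - 1) - (l(i := L (s - 1))) j)) =
           weight q u \<theta> N w l * w (L (s - 1)) *
           (\<Prod>j\<in>{1..N}-{i}. (L (t + (1 - \<theta>)) - (l(i := L (s - 1))) j) / (L s - (l(i := L (s - 1))) j))"
          by (simp add: s_def algebra_simps)
      qed (use l in \<open>auto simp: fun_upd_idem\<close>)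
      then show "?F2 l + ?F1 (l(i := L (s - 1))) = 0" by (simp add: add.commute)
    next
      fix l assume l: "l \<in> X" "l i = L s" "l(i := L (s - 1)) \<notin> X"
      have s0: "0 \<le> s" using B(1) by (simp add: s_def)
      from l(1) i s0 l(2) show "?F2 l = 0"
      proof (cases rule: decrement)
        case move
        then show ?thesis using l by simp
      next
        case blocked
        then show ?thesis using residue2_blocked[of "i - 1" i z l] sig[of "1 - \<theta>"]
          by (simp add: s_def algebra_simps)
      next
        case (edge j)
        then have "t = real_of_int (a j) - 1 + real (psum n (j - 1)) * \<theta>" by (simp add: s_def)
        then show ?thesis using p2[OF edge(1)] B(3) by simp
      qed
    next
      fix l assume l: "l \<in> X" "l i = L (s - 1)" "l(i := L s) \<notin> X"
      have s0: "0 \<le> s - 1" using B(1) by (simp add: s_def)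
      from l(1) i s0 l(2) show "?F1 l = 0"
      proof (cases rule: increment)
        case move
        then show ?thesis using l by simp
      next
        case blocked
        then show ?thesis using residue1_blocked[of "i + 1" i z l] sig[of \<theta>] by (simp add: s_def)
      next
        case (edge j)
        then have "t = real_of_int (b j) - 1 + (real (psum n j) - 1) * \<theta>" by (simp add: s_def)
        then show ?thesis using m2[OF edge(1)] B(3) by simp
      qed
    qed
    then show ?thesis unfolding sumF xy by (simp add: add.commute)
  next
    case N
    \<comment> \<open>In this case a particle responsible for a pole has exponent below 1, so
      \<open>decrement\<close> cannot return \<open>move\<close> and each term vanishes
      alone.\<close>
    have "?F1 l = 0" if l: "l \<in> X" "of_real (l i) = sigma u z" for l
    proof -
      obtain x where x: "admissible x" "l = config x" using l(1) state_space_eq by auto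
      define s where "s = exponent x i"
      have s: "0 \<le> s" "l i = L s" using x i exponent_nonneg by (auto simp: s_def config_apply)
      have zs: "z = of_real (q powr (- s))"
        using sigma_eq_lattice[OF q(1) u(1), of z s] l(2) s N(2)[of s] by auto
      from l(1) i s show "?F1 l = 0"
      proof (cases rule: decrement)
        case move
        then show ?thesis using N(1) zs by blast
      next
        case blocked
        have "sigma u (of_real (q powr \<theta>) * z) = of_real (L (s - \<theta>))"
          using sigma_lattice[of u q "s - \<theta>"] unfolding zs lattice_powr by simp
        then show ?thesis using residue1_blocked[of "i - 1" i z l] blocked by simp
      next
        case (edge j)
        then show ?thesis using m1[of j] zs by (simp add: algebra_simps)
      qed
    qed
    moreover have "?F2 l = 0" if l: "l \<in> X" "of_real (l i) = sigma u (of_real q * z)" for l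
    proof -
      obtain x where x: "admissible x" "l = config x" using l(1) state_space_eq by auto
      define s where "s = exponent x i"
      have s: "0 \<le> s" "l i = L s" using x i exponent_nonneg by (auto simp: s_def config_apply)
      have "of_real q * z \<noteq> of_real (q powr (- s))"
      proof
        assume "of_real q * z = of_real (q powr (- s))"
        then have "of_real q * z = of_real q * of_real (q powr (- (s + 1)))"
          using q by (simp add: of_real_mult[symmetric] powr_mult_base del: of_real_mult)
        then show False using N(1)[of "s + 1"] s q by simp
      qed
      then have "u \<noteq> 0" "of_real q * z = of_real (u * q powr s)"
        using sigma_eq_lattice[OF q(1) u(1), of "of_real q * z" s] l(2) s by auto
      moreover from this have "of_real q * z = of_real q * of_real (u * q powr (s - 1))"
        using q by (simp add: powr_diff)
      ultimately have zs: "u \<noteq> 0" "z = of_real (u * q powr (s - 1))" using q by auto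
      from l(1) i s show "?F2 l = 0"
      proof (cases rule: decrement)
        case move
        then show ?thesis using N(2)[of "s - 1"] zs by auto
      next
        case blocked
        have "of_real (q powr (1 - \<theta>)) * z = of_real (u * q powr (s - \<theta>))"
          unfolding zs(2) by (simp add: powr_add[symmetric] mult.left_commute flip: of_real_mult)
        then have "sigma u (of_real (q powr (1 - \<theta>)) * z) = of_real (L (s - \<theta>))"
          using sigma_lattice'[OF zs(1), of q "s - \<theta>"] by simp
        then show ?thesis using residue2_blocked[of "i - 1" i z l] blocked by simp
      next
        case (edge j)
        then have eq: "s - 1 = real_of_int (a j) - 1 + real (psum n (j - 1)) * \<theta>" by simp
        have "\<Phi>p z = 0" by (rule p2[OF edge(1)]) (simp only: zs(2) eq)
        then show ?thesis by simp
      qed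
    qed
    ultimately show ?thesis unfolding sumF by (simp add: sum.neutral)
  qed
qed

end

section \<open>Analytic continuation and growth\<close>

lemma analytic_sigma:
  assumes "z0 \<noteq> 0 \<or> u = 0" "c \<noteq> 0"
  shows "(\<lambda>z. sigma u (c * z)) analytic_on {z0}"
proof (cases "u = 0")
  case True
  then have "(\<lambda>z. sigma u (c * z)) = (\<lambda>z. c * z)" by (simp add: sigma_def fun_eq_iff)
  then show ?thesis by (simp add: analytic_intros)
next
  case False
  then show ?thesis using assms unfolding sigma_def
    by (intro analytic_on_add analytic_on_mult analytic_on_divide analytic_on_const analytic_on_ident) auto
qed

text \<open>For u \<noteq> 0 numerator and denominator both have a simple pole at 0, and multiplying
  both by z exposes the finite limit. For u = 0 the limit is l / l, where l \<noteq> 0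
  enters.\<close>

lemma sigma_quotient_at_0:
  fixes c d l :: complex
  assumes "c \<noteq> 0" "d \<noteq> 0" "l \<noteq> 0"
  shows "\<exists>e. ((\<lambda>z. (sigma u (c * z) - l) / (sigma u (d * z) - l)) \<longlongrightarrow> e) (at 0)"
proof (cases "u = 0")
  case True
  have "((\<lambda>z. (c * z - l) / (d * z - l)) \<longlongrightarrow> (c * 0 - l) / (d * 0 - l)) (at 0)"
    by (intro tendsto_intros) (use assms in auto)
  then show ?thesis using True by (auto simp: sigma_def)
next
  case False
  let ?f = "\<lambda>z. (c * z * z + of_real u / c - l * z) / (d * z * z + of_real u / d - l * z)"
  have "(?f \<longlongrightarrow> (c * 0 * 0 + of_real u / c - l * 0) / (d * 0 * 0 + of_real u / d - l * 0)) (at 0)"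
    (is "(_ \<longlongrightarrow> ?e) _")
    by (intro tendsto_intros) (use assms False in auto)
  moreover have "\<forall>\<^sub>F z in at 0. ?f z = (sigma u (c * z) - l) / (sigma u (d * z) - l)"
  proof (rule eventually_mono[OF eventually_neq_at_within[of 0]])
    fix z :: complex assume z: "z \<noteq> 0"
    have "e * z * z + of_real u / e - l * z = z * (sigma u (e * z) - l)" for e
      using z by (simp add: sigma_def algebra_simps)
    then show "?f z = (sigma u (c * z) - l) / (sigma u (d * z) - l)"
      using mult_divide_mult_cancel_left[OF z] by (simp only:)
  qed
  ultimately have "((\<lambda>z. (sigma u (c * z) - l) / (sigma u (d * z) - l)) \<longlongrightarrow> ?e) (at 0)"
    by (rule Lim_transform_eventually)
  then show ?thesis by (rule exI)
qed

lemma sigma_quotient_at_infinity: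
  fixes c d l :: complex
  assumes "c \<noteq> 0" "d \<noteq> 0"
  shows "((\<lambda>z. (sigma u (c * z) - l) / (sigma u (d * z) - l)) \<longlongrightarrow> c / d) at_infinity"
proof -
  let ?f = "\<lambda>z. (c + of_real u / c * inverse z * inverse z - l * inverse z) /
    (d + of_real u / d * inverse z * inverse z - l * inverse z)"
  have "(?f \<longlongrightarrow> (c + of_real u / c * 0 * 0 - l * 0) / (d + of_real u / d * 0 * 0 - l * 0)) at_infinity"
    by (intro tendsto_intros tendsto_inverse_0) (use assms in auto)
  then have "(?f \<longlongrightarrow> c / d) at_infinity" by simp
  moreover have "\<forall>\<^sub>F z in at_infinity. ?f z = (sigma u (c * z) - l) / (sigma u (d * z) - l)"
    unfolding eventually_at_infinity
  proof (intro exI[of _ 1] allI impI)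
    fix z :: complex assume "1 \<le> norm z"
    then have z: "z \<noteq> 0" by auto
    have "sigma u (e * z) - l = z * (e + of_real u / e * inverse z * inverse z - l * inverse z)" for e
    proof -
      have "z * (e + f * y * y - l * y) = e * z + f * y * (z * y) - l * (z * y)" for f y
        by (simp add: algebra_simps)
      then have "z * (e + of_real u / e * inverse z * inverse z - l * inverse z)
          = e * z + of_real u / e * inverse z * (z * inverse z) - l * (z * inverse z)" .
      then show ?thesis using z by (simp add: sigma_def divide_inverse mult.assoc)
    qed
    then show "?f z = (sigma u (c * z) - l) / (sigma u (d * z) - l)"
      using mult_divide_mult_cancel_left[OF z] by (simp only:)
  qed
  ultimately show ?thesis by (rule Lim_transform_eventually)
qed

lemma norm_poly_le:
  fixes p :: "complex poly"
  assumes "degree p \<le> d" "1 \<le> norm z"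
  shows "norm (poly p z) \<le> (\<Sum>i\<le>degree p. norm (coeff p i)) * norm z ^ d"
proof -
  have "norm (poly p z) \<le> (\<Sum>i\<le>degree p. norm (coeff p i * z ^ i))"
    unfolding poly_altdef by (rule norm_sum)
  also have "\<dots> \<le> (\<Sum>i\<le>degree p. norm (coeff p i) * norm z ^ d)"
    using assms by (intro sum_mono) (auto simp: norm_mult norm_power intro!: mult_left_mono power_increasing)
  finally show ?thesis by (simp add: sum_distrib_right)
qed

section \<open>The two expectations as finite sums of rational functions\<close>

context quadratic_ensemble
begin

abbreviation "P \<equiv> log_gas q u \<theta> N k n a b w"
abbreviation "poles \<equiv> exceptional_points q u N X"

definition prob :: "(nat \<Rightarrow> real) \<Rightarrow> real" where
  "prob l = weight q u \<theta> N w l / (\<Sum>l\<in>X. weight q u \<theta> N w l)"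

text \<open>The state space is finite, and nonnegativity of \<open>prob\<close> ensures that the
  passage through \<open>ennreal\<close> truncates nothing.\<close>

lemma integral_log_gas:
  fixes f :: "(nat \<Rightarrow> real) \<Rightarrow> complex"
  shows "(\<integral>l. f l \<partial>P) = (\<Sum>l\<in>X. of_real (prob l) * f l)"
proof -
  have "0 \<le> prob l" if "l \<in> X" for l
    unfolding prob_def using that weight_pos by (intro divide_nonneg_nonneg sum_nonneg) (auto intro: less_imp_le)
  then show ?thesis
    unfolding log_gas_def Let_def prob_def[symmetric]
    by (subst lebesgue_integral_point_measure_finite) (auto simp: finite_state_space scaleR_conv_of_real)
qed

text \<open>Common form of both expectations, so that regularity, residues and growth are computed
  once for general c and d.\<close>

definition quotient_mean :: "complex \<Rightarrow> complex \<Rightarrow> complex \<Rightarrow> complex" where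
  "quotient_mean c d z = (\<Sum>l\<in>X. of_real (prob l) *
     (\<Prod>i\<in>{1..N}. (sigma u (c * z) - of_real (l i)) / (sigma u (d * z) - of_real (l i))))"

abbreviation "mean1 \<equiv> quotient_mean (of_real (q powr \<theta>)) 1"
abbreviation "mean2 \<equiv> quotient_mean (of_real (q powr (1 - \<theta>))) (of_real q)"

lemma R_tilde_eq: "R_tilde q u \<theta> N P \<Phi>p \<Phi>m z = \<Phi>m z * mean1 z + \<Phi>p z * mean2 z"
  unfolding R_tilde_def integral_log_gas quotient_mean_def by simp

lemma state_value:
  assumes "l \<in> X" "i \<in> {1..N}"
  obtains s j where "l i = L s" "0 \<le> s" "j \<in> {1..k}"
    "real_of_int (a j) + real (psum n (j - 1)) * \<theta> \<le> s"
    "s \<le> (real_of_int (b j) - 1) + (real (psum n j) - 1) * \<theta>"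
proof -
  obtain x where x: "admissible x" "l = config x" using assms(1) state_space_eq by auto
  obtain j where "j \<in> {1..k}"
    "real_of_int (a j) + real (psum n (j - 1)) * \<theta> \<le> exponent x i"
    "exponent x i \<le> (real_of_int (b j) - 1) + (real (psum n j) - 1) * \<theta>"
    using exponent_in_block[OF x(1) assms(2)] by metis
  then show thesis
    using that exponent_nonneg[OF x(1) assms(2)] config_apply[OF assms(2)] x(2) by blast
qed

lemma state_value_nonzero: "l \<in> X \<Longrightarrow> i \<in> {1..N} \<Longrightarrow> l i \<noteq> 0"
  by (metis state_value quad_lattice_pos q(1) u(1) less_irrefl)

text \<open>Gaps of at least \<theta> > 0 separate the exponents; hence at most one factor of each
  product is singular at a given point.\<close>

lemma state_inj:
  assumes "l \<in> X"
  shows "inj_on (\<lambda>i. of_real (l i) :: complex) {1..N}"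
proof -
  obtain x where x: "admissible x" "l = config x" using assms(1) state_space_eq by auto
  have "l i \<noteq> l j" if "i \<in> {1..N}" "j \<in> {1..N}" "i < j" for i j
    using exponent_gap[OF x(1) that] exponent_nonneg[OF x(1)] that \<theta>
    by (simp add: x(2) config_apply L_eq_iff)
  then show ?thesis by (intro linorder_inj_onI') auto
qed

lemma finite_sigma_fiber: "0 \<le> s \<Longrightarrow> finite {z. sigma u z = of_real (L s)}"
  by (rule finite_subset[of _ "{of_real (q powr (- s)), of_real (u * q powr s)}"])
     (use sigma_eq_lattice[OF q(1) u(1)] in auto)

lemma finite_poles: "finite poles"
proof -
  have fin: "finite {z. sigma u z = of_real (l i)}" if "l \<in> X" "i \<in> {1..N}" for l i
    using state_value[OF that] finite_sigma_fiber by metis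
  have "inj (\<lambda>z::complex. of_real q * z)" using q by (auto simp: inj_def)
  then have "finite ((\<lambda>z. of_real q * z) -` {z. sigma u z = of_real (l i)})" if "l \<in> X" "i \<in> {1..N}" for l i
    using fin[OF that] by (rule finite_vimageI[rotated])
  moreover have "poles \<subseteq> {0} \<union> (\<Union>l\<in>X. \<Union>i\<in>{1..N}. {z. sigma u z = of_real (l i)} \<union>
      (\<lambda>z. of_real q * z) -` {z. sigma u z = of_real (l i)})"
    unfolding exceptional_points_def by auto
  ultimately show ?thesis
    using fin finite_state_space by (elim finite_subset) (intro finite_UnI finite_UN_I finite.intros; auto)
qed

text \<open>For a particle of exponent s the poles are q^(-e) with e = s or s + 1, and u q^e with e
  = s or s - 1. As s runs through band j, e stays between a j - 1 + N_(j-1) \<theta> and b j + (N_j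
  - 1) \<theta>, the range covered by the assumed intervals.\<close>

lemma pole_location:
  assumes "z \<in> poles" "z \<noteq> 0"
  obtains j where "j \<in> {1..k}"
    "z \<in> complex_of_real ` {q powr (1 - real_of_int (a j) - real (psum n (j - 1)) * \<theta>) ..
              q powr (- real_of_int (b j) - (real (psum n j) - 1) * \<theta>)} \<union>
         complex_of_real ` {u * q powr (real_of_int (b j) + (real (psum n j) - 1) * \<theta>) ..
              u * q powr (real_of_int (a j) - 1 + real (psum n (j - 1)) * \<theta>)}"
proof -
  obtain l i where li: "l \<in> X" "i \<in> {1..N}" "sigma u z = of_real (l i) \<or> sigma u (of_real q * z) = of_real (l i)"
    using assms unfolding exceptional_points_def by auto
  obtain s j where s: "l i = L s" "0 \<le> s" "j \<in> {1..k}"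
    "real_of_int (a j) + real (psum n (j - 1)) * \<theta> \<le> s"
    "s \<le> (real_of_int (b j) - 1) + (real (psum n j) - 1) * \<theta>"
    using state_value[OF li(1,2)] by metis
  have "(\<exists>e. (e = s \<or> e = s + 1) \<and> z = of_real (q powr (- e))) \<or>
        (\<exists>e. (e = s \<or> e = s - 1) \<and> z = of_real (u * q powr e))"
    using li(3)
  proof
    assume "sigma u z = of_real (l i)"
    then show ?thesis using sigma_eq_lattice[OF q(1) u(1), of z s] s(1) by auto
  next
    assume "sigma u (of_real q * z) = of_real (l i)"
    then have "of_real q * z = of_real (q powr (- s)) \<or> of_real q * z = of_real (u * q powr s)"
      using sigma_eq_lattice[OF q(1) u(1), of "of_real q * z" s] s(1) by auto
    moreover have "q powr (- s) = q * q powr (- (s + 1))" "u * q powr s = q * (u * q powr (s - 1))"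
      using q by (simp_all add: powr_mult_base)
    ultimately have "of_real q * z = of_real q * of_real (q powr (- (s + 1))) \<or>
        of_real q * z = of_real q * of_real (u * q powr (s - 1))"
      by (metis of_real_mult)
    then have "z = of_real (q powr (- (s + 1))) \<or> z = of_real (u * q powr (s - 1))" using q by simp
    then show ?thesis by blast
  qed
  then show thesis
  proof
    assume "\<exists>e. (e = s \<or> e = s + 1) \<and> z = of_real (q powr (- e))"
    then obtain e where e: "e = s \<or> e = s + 1" "z = of_real (q powr (- e))" by blast
    have "q powr (- e) \<in> {q powr (1 - real_of_int (a j) - real (psum n (j - 1)) * \<theta>) ..
              q powr (- real_of_int (b j) - (real (psum n j) - 1) * \<theta>)}"
      using e(1) s q unfolding atLeastAtMost_iff by (intro conjI powr_mono') auto
    then show thesis using that[OF s(3)] e(2) by blast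
  next
    assume "\<exists>e. (e = s \<or> e = s - 1) \<and> z = of_real (u * q powr e)"
    then obtain e where e: "e = s \<or> e = s - 1" "z = of_real (u * q powr e)" by blast
    have "u * q powr e \<in> {u * q powr (real_of_int (b j) + (real (psum n j) - 1) * \<theta>) ..
              u * q powr (real_of_int (a j) - 1 + real (psum n (j - 1)) * \<theta>)}"
      using e(1) s q u unfolding atLeastAtMost_iff by (intro conjI mult_left_mono powr_mono') auto
    then show thesis using that[OF s(3)] e(2) by blast
  qed
qed

text \<open>The critical points of sigma satisfy z^2 = u. At q^(-s) the square is at least 1 > u,
  and at u q^s it is below u, so lattice values are not critical values.\<close>

lemma sigma_value_nondegenerate:
  assumes "sigma u z = of_real (L s)" "0 \<le> s"
  shows "z\<^sup>2 \<noteq> of_real u"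
proof -
  consider "z = of_real (q powr (- s))" | "u \<noteq> 0" "z = of_real (u * q powr s)"
    using sigma_eq_lattice[OF q(1) u(1) assms(1)] by blast
  then have "\<exists>c. z\<^sup>2 = of_real c \<and> c \<noteq> u"
  proof cases
    case 1
    have "1 \<le> q powr (- s)" using powr_mono'[of "- s" 0 q] q assms(2) by simp
    then have "1 \<le> (q powr (- s))\<^sup>2" by (rule one_le_power)
    then show ?thesis using 1 u by (intro exI[of _ "(q powr (- s))\<^sup>2"]) simp
  next
    case 2
    have "u * q powr s < 1" using u_powr_less_1[OF q u assms(2)] .
    moreover have "q powr s \<le> 1" using powr_mono'[of 0 s q] q assms(2) by simp
    moreover have "0 < u" using 2(1) u by simp
    ultimately have "(u * q powr s) * u < 1 * u" "(u * q powr s) * (u * q powr s) \<le> (u * q powr s) * u"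
      by (intro mult_strict_right_mono mult_left_mono; simp add: mult_left_le)+
    then have "(u * q powr s)\<^sup>2 < u" unfolding power2_eq_square by linarith
    then have "(u * q powr s)\<^sup>2 \<noteq> u" by (rule less_imp_neq)
    moreover have "z\<^sup>2 = of_real ((u * q powr s)\<^sup>2)" by (simp add: 2(2))
    ultimately show ?thesis by blast
  qed
  then show ?thesis by auto
qed

lemma analytic_quotient_mean:
  assumes "z0 \<noteq> 0 \<or> u = 0" "c \<noteq> 0" "d \<noteq> 0"
    and "\<And>l i. l \<in> X \<Longrightarrow> i \<in> {1..N} \<Longrightarrow> sigma u (d * z0) \<noteq> of_real (l i)"
  shows "quotient_mean c d analytic_on {z0}"
  unfolding quotient_mean_def
  by (intro analytic_on_sum analytic_on_mult analytic_on_prod analytic_on_divide analytic_on_diff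
      analytic_sigma analytic_on_const) (use assms in auto)

lemma analytic_R_tilde:
  assumes "z0 \<notin> poles" "\<Phi>p analytic_on {z0}" "\<Phi>m analytic_on {z0}"
  shows "R_tilde q u \<theta> N P \<Phi>p \<Phi>m analytic_on {z0}"
proof -
  have "(\<lambda>z. \<Phi>m z * mean1 z + \<Phi>p z * mean2 z) analytic_on {z0}"
    by (intro analytic_on_add analytic_on_mult assms analytic_quotient_mean)
       (use assms(1) q in \<open>auto simp: exceptional_points_def\<close>)
  then show ?thesis unfolding R_tilde_eq .
qed

lemma quotient_mean_at_0:
  assumes "c \<noteq> 0" "d \<noteq> 0"
  shows "\<exists>e. (quotient_mean c d \<longlongrightarrow> e) (at 0)"
proof -
  have "\<forall>l\<in>X. \<forall>i\<in>{1..N}. \<exists>e. ((\<lambda>z. (sigma u (c * z) - of_real (l i)) / (sigma u (d * z) - of_real (l i))) \<longlongrightarrow> e) (at 0)"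
    using sigma_quotient_at_0[OF assms] state_value_nonzero by auto
  then obtain e where "\<And>l i. l \<in> X \<Longrightarrow> i \<in> {1..N} \<Longrightarrow>
      ((\<lambda>z. (sigma u (c * z) - of_real (l i)) / (sigma u (d * z) - of_real (l i))) \<longlongrightarrow> e l i) (at 0)"
    by metis
  then have "(quotient_mean c d \<longlongrightarrow> (\<Sum>l\<in>X. of_real (prob l) * (\<Prod>i\<in>{1..N}. e l i))) (at 0)"
    unfolding quotient_mean_def by (intro tendsto_sum tendsto_mult tendsto_const tendsto_prod)
  then show ?thesis by blast
qed

lemma quotient_mean_bounded_at_infinity:
  assumes "c \<noteq> 0" "d \<noteq> 0"
  obtains C where "0 < C" "\<forall>\<^sub>F z in at_infinity. norm (quotient_mean c d z) < C"
proof -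
  have "(quotient_mean c d \<longlongrightarrow> (\<Sum>l\<in>X. of_real (prob l) * (\<Prod>i\<in>{1..N}. c / d))) at_infinity"
    (is "(_ \<longlongrightarrow> ?e) _")
    unfolding quotient_mean_def
    by (intro tendsto_sum tendsto_mult tendsto_const tendsto_prod sigma_quotient_at_infinity assms)
  then have "((\<lambda>z. norm (quotient_mean c d z)) \<longlongrightarrow> norm ?e) at_infinity"
    by (rule tendsto_norm)
  then have "\<forall>\<^sub>F z in at_infinity. norm (quotient_mean c d z) < norm ?e + 1"
    by (rule order_tendstoD(2)) simp
  moreover have "0 < norm ?e + 1" by (rule add_nonneg_pos) simp_all
  ultimately show thesis by (rule that[rotated])
qed

lemma quotient_mean_residue:
  assumes "z0 \<noteq> 0" "c \<noteq> 0" "d \<noteq> 0"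
    and "\<And>l i. l \<in> X \<Longrightarrow> i \<in> {1..N} \<Longrightarrow> of_real (l i) = sigma u (d * z0) \<Longrightarrow> d - of_real u / (d * z0\<^sup>2) \<noteq> 0"
  shows "((\<lambda>z. (z - z0) * quotient_mean c d z) \<longlongrightarrow>
    (\<Sum>l\<in>X. of_real (prob l) * (\<Sum>i | i \<in> {1..N} \<and> of_real (l i) = sigma u (d * z0).
       (sigma u (c * z0) - of_real (l i)) / (d - of_real u / (d * z0\<^sup>2)) *
       (\<Prod>j\<in>{1..N}-{i}. (sigma u (c * z0) - of_real (l j)) / (sigma u (d * z0) - of_real (l j)))))) (at z0)"
proof -
  have "((\<lambda>z. \<Sum>l\<in>X. of_real (prob l) * ((z - z0) *
      (\<Prod>i\<in>{1..N}. (sigma u (c * z) - of_real (l i)) / (sigma u (d * z) - of_real (l i))))) \<longlongrightarrow>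
    (\<Sum>l\<in>X. of_real (prob l) * (\<Sum>i | i \<in> {1..N} \<and> of_real (l i) = sigma u (d * z0).
       (sigma u (c * z0) - of_real (l i)) / (d - of_real u / (d * z0\<^sup>2)) *
       (\<Prod>j\<in>{1..N}-{i}. (sigma u (c * z0) - of_real (l j)) / (sigma u (d * z0) - of_real (l j)))))) (at z0)"
  proof (intro tendsto_sum tendsto_mult tendsto_const tendsto_simple_pole_prod)
    show "isCont (\<lambda>z. sigma u (c * z)) z0"
      using sigma_has_derivative[OF assms(1,2)] by (rule DERIV_isCont)
    show "((\<lambda>z. sigma u (d * z)) has_field_derivative d - of_real u / (d * z0\<^sup>2)) (at z0)"
      using sigma_has_derivative[OF assms(1,3)] .
  qed (use state_inj assms(4) in auto)
  then show ?thesis unfolding quotient_mean_def by (simp add: sum_distrib_left mult_ac)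
qed

text \<open>The limit first appears as a sum over configurations and then labels, whereas
  cancellation is known label by label; interchanging the two finite sums reconciles them.\<close>

lemma R_tilde_no_residue:
  fixes z0 :: complex
  assumes cont: "isCont \<Phi>p z0" "isCont \<Phi>m z0" and "z0 \<noteq> 0"
    and cancel: "\<And>i. i \<in> {1..N} \<Longrightarrow>
      \<Phi>m z0 * (\<Sum>l | l \<in> X \<and> of_real (l i) = sigma u z0. of_real (weight q u \<theta> N w l) * residue1 z0 l i) +
      \<Phi>p z0 * (\<Sum>l | l \<in> X \<and> of_real (l i) = sigma u (of_real q * z0).
        of_real (weight q u \<theta> N w l) * residue2 z0 l i) = 0"
  shows "((\<lambda>z. (z - z0) * R_tilde q u \<theta> N P \<Phi>p \<Phi>m z) \<longlongrightarrow> 0) (at z0)"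
proof -
  let ?r1 = "\<Sum>l\<in>X. of_real (prob l) * (\<Sum>i | i \<in> {1..N} \<and> of_real (l i) = sigma u z0. residue1 z0 l i)"
  let ?r2 = "\<Sum>l\<in>X. of_real (prob l) *
    (\<Sum>i | i \<in> {1..N} \<and> of_real (l i) = sigma u (of_real q * z0). residue2 z0 l i)"
  have ne1: "1 - of_real u / (1 * z0\<^sup>2) \<noteq> (0::complex)"
    if li: "l \<in> X" "i \<in> {1..N}" "of_real (l i) = sigma u (1 * z0)" for l i
  proof -
    obtain s where "l i = L s" "0 \<le> s" using state_value[OF li(1,2)] by metis
    then have "z0\<^sup>2 \<noteq> of_real u" using sigma_value_nondegenerate[of z0 s] li(3) by simp
    then show ?thesis using assms(3) by (simp add: field_simps)
  qed
  have ne2: "of_real q - of_real u / (of_real q * z0\<^sup>2) \<noteq> (0::complex)"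
    if li: "l \<in> X" "i \<in> {1..N}" "of_real (l i) = sigma u (of_real q * z0)" for l i
  proof -
    obtain s where "l i = L s" "0 \<le> s" using state_value[OF li(1,2)] by metis
    then have "(of_real q * z0)\<^sup>2 \<noteq> of_real u"
      using sigma_value_nondegenerate[of "of_real q * z0" s] li(3) by simp
    then show ?thesis using assms(3) q by (simp add: field_simps power2_eq_square)
  qed
  have "((\<lambda>z. (z - z0) * mean1 z) \<longlongrightarrow> ?r1) (at z0)"
    using quotient_mean_residue[of z0 "of_real (q powr \<theta>)" 1, OF assms(3) _ _ ne1] q
    unfolding residue1_def by simp
  moreover have "((\<lambda>z. (z - z0) * mean2 z) \<longlongrightarrow> ?r2) (at z0)"
    using quotient_mean_residue[of z0 "of_real (q powr (1 - \<theta>))" "of_real q", OF assms(3) _ _ ne2] q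
    unfolding residue2_def by simp
  ultimately have "((\<lambda>z. \<Phi>m z * ((z - z0) * mean1 z) + \<Phi>p z * ((z - z0) * mean2 z)) \<longlongrightarrow>
      \<Phi>m z0 * ?r1 + \<Phi>p z0 * ?r2) (at z0)"
    using cont unfolding isCont_def by (intro tendsto_add tendsto_mult)
  moreover have "\<Phi>m z0 * ?r1 + \<Phi>p z0 * ?r2 = 0"
  proof -
    define Z where "Z = complex_of_real (\<Sum>l\<in>X. weight q u \<theta> N w l)"
    have swap: "(\<Sum>l\<in>X. of_real (prob l) * (\<Sum>i | i \<in> {1..N} \<and> of_real (l i) = v. r l i)) =
      (\<Sum>i\<in>{1..N}. \<Sum>l | l \<in> X \<and> of_real (l i) = v. of_real (weight q u \<theta> N w l) * r l i) / Z"
      for r :: "(nat \<Rightarrow> real) \<Rightarrow> nat \<Rightarrow> complex" and v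
    proof -
      have "(\<Sum>l\<in>X. of_real (prob l) * (\<Sum>i | i \<in> {1..N} \<and> of_real (l i) = v. r l i)) =
        (\<Sum>l\<in>X. \<Sum>i | i \<in> {1..N} \<and> of_real (l i) = v. of_real (weight q u \<theta> N w l) * r l i) / Z"
        by (simp add: prob_def Z_def sum_distrib_left sum_divide_distrib)
      then show ?thesis by (simp only: sum.swap_restrict[OF finite_state_space finite_atLeastAtMost])
    qed
    have "\<Phi>m z0 * ?r1 + \<Phi>p z0 * ?r2 = (\<Sum>i\<in>{1..N}.
      \<Phi>m z0 * (\<Sum>l | l \<in> X \<and> of_real (l i) = sigma u z0. of_real (weight q u \<theta> N w l) * residue1 z0 l i) +
      \<Phi>p z0 * (\<Sum>l | l \<in> X \<and> of_real (l i) = sigma u (of_real q * z0).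
        of_real (weight q u \<theta> N w l) * residue2 z0 l i)) / Z"
      unfolding swap sum.distrib sum_distrib_left[symmetric] add_divide_distrib by simp
    also have "\<dots> = 0" using cancel by simp
    finally show ?thesis .
  qed
  ultimately show ?thesis unfolding R_tilde_eq by (simp add: algebra_simps)
qed

text \<open>Stated pointwise, because in the polynomial case the continuations of \<open>\<Phi>\<^sup>+\<close>, \<open>\<Phi>\<^sup>-\<close> are entire but satisfy
  the hypotheses only on \<open>\<M>\<close>, which contains every pole except possibly \<open>0\<close>.\<close>

definition local_hypotheses :: "(complex \<Rightarrow> complex) \<Rightarrow> (complex \<Rightarrow> complex) \<Rightarrow> complex \<Rightarrow> bool" where
  "local_hypotheses \<Phi>p \<Phi>m z \<longleftrightarrow>
     weight_ratio_condition q u \<theta> (bands q u \<theta> k n a b) w {z} \<Phi>p \<Phi>m \<and>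
     (\<forall>j\<in>{1..k}.
       (z = of_real (q powr (- real_of_int (b j) - (real (psum n j) - 1) * \<theta>)) \<longrightarrow> \<Phi>p z = 0) \<and>
       (z = of_real (q powr (- real_of_int (a j) - real (psum n (j - 1)) * \<theta>)) \<longrightarrow> \<Phi>m z = 0) \<and>
       (z = of_real (u * q powr (real_of_int (a j) - 1 + real (psum n (j - 1)) * \<theta>)) \<longrightarrow> \<Phi>p z = 0) \<and>
       (z = of_real (u * q powr (real_of_int (b j) - 1 + (real (psum n j) - 1) * \<theta>)) \<longrightarrow> \<Phi>m z = 0))"

text \<open>At the origin the expectations converge, so the factor z - z0 forces the limit 0;
  elsewhere \<open>residues_cancel\<close> applies.\<close>

lemma R_tilde_simple_limit:
  assumes "isCont \<Phi>p z0" "isCont \<Phi>m z0" "z0 \<noteq> 0 \<Longrightarrow> local_hypotheses \<Phi>p \<Phi>m z0"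
  shows "((\<lambda>z. (z - z0) * R_tilde q u \<theta> N P \<Phi>p \<Phi>m z) \<longlongrightarrow> 0) (at z0)"
proof (cases "z0 = 0")
  case True
  obtain e1 where e1: "(mean1 \<longlongrightarrow> e1) (at 0)"
    using quotient_mean_at_0[of "of_real (q powr \<theta>)" 1] q by auto
  obtain e2 where e2: "(mean2 \<longlongrightarrow> e2) (at 0)"
    using quotient_mean_at_0[of "of_real (q powr (1 - \<theta>))" "of_real q"] q by auto
  have "((\<lambda>z. (z - 0) * (\<Phi>m z * mean1 z + \<Phi>p z * mean2 z)) \<longlongrightarrow> (0 - 0) * (\<Phi>m 0 * e1 + \<Phi>p 0 * e2)) (at 0)"
    using assms(1,2) e1 e2 unfolding True isCont_def by (intro tendsto_intros)
  then show ?thesis unfolding R_tilde_eq True by simp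
next
  case False
  show ?thesis
    by (intro R_tilde_no_residue assms(1,2) False residues_cancel)
       (use assms(3)[OF False] in \<open>auto simp: local_hypotheses_def\<close>)
qed

text \<open>The poles are finite in number, hence isolated, and a limit 0 after multiplication by z
  - z0 makes each of them removable.\<close>

lemma remove_sings_R_tilde:
  assumes "open U" "\<Phi>p analytic_on U" "\<Phi>m analytic_on U"
    and hyp: "\<And>z. z \<in> U \<Longrightarrow> z \<in> poles \<Longrightarrow> z \<noteq> 0 \<Longrightarrow> local_hypotheses \<Phi>p \<Phi>m z"
  defines "R \<equiv> R_tilde q u \<theta> N P \<Phi>p \<Phi>m"
  shows "remove_sings R analytic_on U" and "\<And>z. z \<in> U - poles \<Longrightarrow> remove_sings R z = R z"
proof -
  have an: "R analytic_on {z}" if "z \<in> U - poles" for z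
    unfolding R_def using that assms(2,3) analytic_on_analytic_at
    by (intro analytic_R_tilde) blast+
  show "remove_sings R z = R z" if "z \<in> U - poles" for z
    using an[OF that] by simp
  show "remove_sings R analytic_on U"
    unfolding analytic_on_analytic_at[of _ U]
  proof
    fix z0 assume z0: "z0 \<in> U"
    show "remove_sings R analytic_on {z0}"
    proof (cases "z0 \<in> poles")
      case False
      then show ?thesis using an z0 remove_sings_analytic_on by blast
    next
      case True
      have "open (U - (poles - {z0}))"
        using assms(1) finite_poles by (intro open_Diff finite_imp_closed) auto
      then obtain r where r: "0 < r" "ball z0 r \<subseteq> U - (poles - {z0})"
        using z0 True by (metis DiffI Diff_iff open_contains_ball singletonI)
      have an_ball: "R analytic_on ball z0 r - {z0}"
        using an r(2) analytic_on_analytic_at[of R "ball z0 r - {z0}"] by blast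
      have lim: "((\<lambda>z. (z - z0) * R z) \<longlongrightarrow> 0) (at z0)"
        unfolding R_def
        by (rule R_tilde_simple_limit)
          (use z0 True hyp assms(2,3) analytic_on_analytic_at analytic_at_imp_isCont in blast)+
      have "z0 \<in> interior (ball z0 r)" using r(1) by simp
      with lim obtain g where g: "g holomorphic_on ball z0 r" "\<forall>z\<in>ball z0 r - {z0}. g z = R z"
        using holomorphic_on_extend_lim[OF analytic_imp_holomorphic[OF an_ball]] by blast
      have "g \<midarrow>z0\<rightarrow> g z0"
        using g(1) r(1) holomorphic_on_imp_continuous_on continuous_on_interior isCont_def
          \<open>z0 \<in> interior (ball z0 r)\<close> by blast
      moreover have "\<forall>\<^sub>F z in at z0. g z = R z"
        unfolding eventually_at using g(2) r(1) by (intro exI[of _ r]) (auto simp: dist_commute)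
      ultimately have "R \<midarrow>z0\<rightarrow> g z0" by (rule Lim_transform_eventually)
      moreover have "isolated_singularity_at R z0"
        unfolding isolated_singularity_at_def using r(1) an_ball by blast
      ultimately show ?thesis using remove_sings_analytic_at by blast
    qed
  qed
qed

text \<open>Every factor in the two means tends to a constant at infinity, so both means stay
  bounded there and the growth of the continuation is controlled by the polynomials alone.\<close>

lemma R_tilde_polynomial:
  fixes p m :: "complex poly"
  assumes deg: "degree p \<le> d" "degree m \<le> d"
    and hyp: "\<And>z. z \<in> poles \<Longrightarrow> z \<noteq> 0 \<Longrightarrow> local_hypotheses (poly p) (poly m) z"
  obtains r where "degree r \<le> d" "\<And>z. z \<notin> poles \<Longrightarrow> R_tilde q u \<theta> N P (poly p) (poly m) z = poly r z"
proof -
  define R where "R = R_tilde q u \<theta> N P (poly p) (poly m)"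
  define h where "h = remove_sings R"
  have pan: "poly p' analytic_on UNIV" for p' :: "complex poly"
    unfolding poly_altdef[abs_def] by (intro analytic_intros)
  note rem = remove_sings_R_tilde[OF open_UNIV pan[of p] pan[of m], folded R_def h_def]
  have hol: "h holomorphic_on UNIV" using rem(1) hyp analytic_imp_holomorphic by blast
  have hR: "h z = R z" if "z \<notin> poles" for z using rem(2) hyp that by blast
  obtain C1 where C1: "0 < C1" "\<forall>\<^sub>F z in at_infinity. norm (mean1 z) < C1"
    using quotient_mean_bounded_at_infinity[of "of_real (q powr \<theta>)" 1] q by auto
  obtain C2 where C2: "0 < C2" "\<forall>\<^sub>F z in at_infinity. norm (mean2 z) < C2"
    using quotient_mean_bounded_at_infinity[of "of_real (q powr (1 - \<theta>))" "of_real q"] q by auto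
  define B where "B = (\<Sum>i\<le>degree m. norm (coeff m i)) * C1 + (\<Sum>i\<le>degree p. norm (coeff p i)) * C2"
  obtain b where b: "\<And>z. z \<in> poles \<Longrightarrow> norm z \<le> b"
    using finite_imp_bounded[OF finite_poles] unfolding bounded_iff by blast
  then have "\<forall>\<^sub>F z in at_infinity. z \<notin> poles"
    unfolding eventually_at_infinity by (intro exI[of _ "b + 1"]) fastforce
  moreover have "\<forall>\<^sub>F z :: complex in at_infinity. 1 \<le> norm z"
    unfolding eventually_at_infinity by blast
  ultimately have "\<forall>\<^sub>F z in at_infinity. norm (h z) \<le> B * norm z ^ d"
    using C1(2) C2(2)
  proof eventually_elim
    case (elim z)
    have "norm (h z) \<le> norm (poly m z) * norm (mean1 z) + norm (poly p z) * norm (mean2 z)"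
      unfolding hR[OF elim(1)] R_def R_tilde_eq norm_mult[symmetric] by (rule norm_triangle_ineq)
    also have "\<dots> \<le> ((\<Sum>i\<le>degree m. norm (coeff m i)) * norm z ^ d) * C1 +
        ((\<Sum>i\<le>degree p. norm (coeff p i)) * norm z ^ d) * C2"
      using elim norm_poly_le[OF deg(1) elim(2)] norm_poly_le[OF deg(2) elim(2)]
      by (intro add_mono mult_mono) (auto intro!: mult_nonneg_nonneg sum_nonneg)
    finally show ?case by (simp add: B_def algebra_simps)
  qed
  then obtain A where A: "\<And>z. A \<le> norm z \<Longrightarrow> norm (h z) \<le> B * norm z ^ d"
    unfolding eventually_at_infinity by blast
  \<comment> \<open>The Taylor polynomial of the continuation at 0, in the form delivered by
    \<open>Liouville_polynomial\<close>.\<close>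
  define r where "r = (\<Sum>k\<le>d. monom ((deriv ^^ k) h 0 / fact k) k)"
  have "degree r \<le> d"
    unfolding r_def by (rule degree_sum_le) (auto intro: order_trans[OF degree_monom_le])
  moreover have "R z = poly r z" if "z \<notin> poles" for z
    using Liouville_polynomial[OF hol A, where \<xi> = z] hR[OF that]
    by (simp add: r_def poly_sum poly_monom)
  ultimately show thesis using that unfolding R_def by blast
qed

text \<open>Carries the hypotheses over from the given functions to polynomials that agree with them
  at the point z.\<close>

lemma local_hypotheses_cong:
  assumes "\<Phi>p z = \<Phi>p' z" "\<Phi>m z = \<Phi>m' z"
  shows "local_hypotheses \<Phi>p \<Phi>m z \<longleftrightarrow> local_hypotheses \<Phi>p' \<Phi>m' z"
  unfolding local_hypotheses_def weight_ratio_condition_def by (simp only: ball_simps assms)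

end

theorem theorem4p1p1:
  fixes q u \<theta> :: real and M N k :: nat
    and n :: "nat \<Rightarrow> nat" and a b :: "nat \<Rightarrow> int"
    and w :: "real \<Rightarrow> real" and \<M> :: "complex set" and \<Phi>p \<Phi>m :: "complex \<Rightarrow> complex"
  defines "X \<equiv> state_space q u \<theta> N k n a b"
    and "P \<equiv> log_gas q u \<theta> N k n a b w"
    and "B \<equiv> bands q u \<theta> k n a b"
  assumes "0 < q" "q < 1" "0 \<le> u" "u < 1" "0 < \<theta>"
    and "1 \<le> N" "1 \<le> k" "int N - 1 \<le> int M"
    and "psum n k = N"
    and "\<And>i. i \<in> {1..k} \<Longrightarrow> 0 \<le> a i \<and> a i \<le> b i - 1 \<and> b i - 1 \<le> int M - int N + 1"
    and "\<And>i. i \<in> {1..<k} \<Longrightarrow> b i \<le> a (i + 1)"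
    and "\<And>x. x \<in> B \<Longrightarrow> 0 < w x"
    and "open \<M>"
    and "\<And>i. i \<in> {1..k} \<Longrightarrow>
           complex_of_real ` {q powr (1 - real_of_int (a i) - real (psum n (i - 1)) * \<theta>) ..
                              q powr (- real_of_int (b i) - (real (psum n i) - 1) * \<theta>)} \<union>
           complex_of_real ` {u * q powr (real_of_int (b i) + (real (psum n i) - 1) * \<theta>) ..
                              u * q powr (real_of_int (a i) - 1 + real (psum n (i - 1)) * \<theta>)}
           \<subseteq> \<M>"
    and "\<Phi>p analytic_on \<M>" "\<Phi>m analytic_on \<M>"
    and "weight_ratio_condition q u \<theta> B w \<M> \<Phi>p \<Phi>m"
    and "\<And>i. i \<in> {1..k} \<Longrightarrow>
           \<Phi>p (of_real (q powr (- real_of_int (b i) - (real (psum n i) - 1) * \<theta>))) = 0"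
    and "\<And>i. i \<in> {1..k} \<Longrightarrow>
           \<Phi>m (of_real (q powr (- real_of_int (a i) - real (psum n (i - 1)) * \<theta>))) = 0"
    and "\<And>i. i \<in> {1..k} \<Longrightarrow>
           \<Phi>p (of_real (u * q powr (real_of_int (a i) - 1 + real (psum n (i - 1)) * \<theta>))) = 0"
    and "\<And>i. i \<in> {1..k} \<Longrightarrow>
           \<Phi>m (of_real (u * q powr (real_of_int (b i) - 1 + (real (psum n i) - 1) * \<theta>))) = 0"
  shows "(\<exists>R. R analytic_on \<M> \<and>
            (\<forall>z \<in> \<M> - exceptional_points q u N X. R z = R_tilde q u \<theta> N P \<Phi>p \<Phi>m z)) \<and>
         (\<forall>d. (\<exists>p m :: complex poly. degree p \<le> d \<and> degree m \<le> d \<and>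
                  (\<forall>z\<in>\<M>. \<Phi>p z = poly p z \<and> \<Phi>m z = poly m z)) \<longrightarrow>
              (\<exists>r :: complex poly. degree r \<le> d \<and>
                  (\<forall>z \<in> \<M> - exceptional_points q u N X.
                     R_tilde q u \<theta> N P \<Phi>p \<Phi>m z = poly r z)))"
proof -
  interpret quadratic_ensemble q u \<theta> N k n a b w
    by unfold_locales (use assms(4-8,12,13,15) in \<open>auto simp: B_def\<close>)
  define R where "R = R_tilde q u \<theta> N P \<Phi>p \<Phi>m"
  have local: "local_hypotheses \<Phi>p \<Phi>m z" if "z \<in> \<M>" for z
    unfolding local_hypotheses_def
  proof (intro conjI ballI impI)
    show "weight_ratio_condition q u \<theta> (bands q u \<theta> k n a b) w {z} \<Phi>p \<Phi>m"
      using assms(20) that unfolding weight_ratio_condition_def B_def by blast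
  qed (simp_all only: assms(21-24))
  note continuation = remove_sings_R_tilde[OF assms(16,18,19) local, folded X_def P_def R_def]
  have poly: "\<exists>r :: complex poly. degree r \<le> d \<and>
      (\<forall>z\<in>\<M> - exceptional_points q u N X. R z = poly r z)"
    if deg: "degree p \<le> d" "degree m \<le> d" and eq: "\<forall>z\<in>\<M>. \<Phi>p z = poly p z \<and> \<Phi>m z = poly m z"
    for d and p m :: "complex poly"
  proof -
    \<comment> \<open>The polynomials are known to agree with the given functions only on \<M>;
      \<open>pole_location\<close> puts every nonzero pole there.\<close>
    have hyp: "local_hypotheses (poly p) (poly m) z"
      if z: "z \<in> exceptional_points q u N (state_space q u \<theta> N k n a b)" "z \<noteq> 0" for z
    proof -
      have "z \<in> \<M>" by (rule pole_location[OF z]) (rule subsetD[OF assms(17)])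
      moreover from this have "\<Phi>p z = poly p z" "\<Phi>m z = poly m z" using eq by auto
      ultimately show ?thesis using local[of z] local_hypotheses_cong by blast
    qed
    obtain r where r: "degree r \<le> d" "\<And>z. z \<notin> exceptional_points q u N X \<Longrightarrow>
        R_tilde q u \<theta> N P (poly p) (poly m) z = poly r z"
      using R_tilde_polynomial[OF deg hyp, folded X_def P_def] by blast
    have "R z = R_tilde q u \<theta> N P (poly p) (poly m) z" if "z \<in> \<M>" for z
      using eq that by (simp add: R_def R_tilde_def)
    with r show ?thesis by auto
  qed
  show ?thesis
    unfolding R_def[symmetric]
  proof (intro conjI allI impI)
    show "\<exists>S. S analytic_on \<M> \<and> (\<forall>z\<in>\<M> - exceptional_points q u N X. S z = R z)"
      using continuation by blast
  next
    fix d
    assume "\<exists>p m :: complex poly. degree p \<le> d \<and> degree m \<le> d \<and>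
      (\<forall>z\<in>\<M>. \<Phi>p z = poly p z \<and> \<Phi>m z = poly m z)"
    then show "\<exists>r :: complex poly. degree r \<le> d \<and>
        (\<forall>z\<in>\<M> - exceptional_points q u N X. R z = poly r z)"
      using poly by blast
  qed
qed

end
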